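(* Let $H\colon\mathbb C^2\to\mathbb R$ be a smooth strictly plurisubharmonic function, let $c$ be a regular value of $H$, and let $T\subset\mathbb C^2$ be an embedded totally real $2$-torus with $T\subset M:=H^{-1}(c)$ that admits a local filling. Then cylinders in $T$ cut out by boundary circles of holomorphic discs that belong to an analytic filling of $T$ do not admit trapped characteristics. That is: if $F\colon S^1\times\mathbb D\to\mathbb C^2$ is an analytic filling of $T$ and $a<b\le a+2\pi$ are real numbers, then every leaf of the foliation on the cylinder $[a,b]\times\partial\mathbb D$ obtained by pulling back the characteristic foliation $T_\xi$ of $T$ along $(t,z)\mapsto F(t \bmod 2\pi,z)$ connects the two boundary components $\{a\}\times\partial\mathbb D$ and $\{b\}\times\partial\mathbb D$.
   Context: Notation: $S^1=\mathbb R/2\pi\mathbb Z$ and $\mathbb D=\{|z|\le 1\}\subset\mathbb C$. All maps, embeddings and submanifolds are smooth (up to the boundary). An embedded $2$-torus $T\subset\mathbb C^2$ is totally real if no complex line is tangent to $T$, i.e. $T_pT\cap \mathrm i\,T_pT=\{0\}$ for all $p\in T$. An analytic filling of $T$ is an embedding $F\colon S^1\times\mathbb D\to\mathbb C^2$ such that $F(S^1\times\partial\mathbb D)=T$ and, for all $t\in S^1$, the map $u_t=F(t,\cdot)$ is holomorphic on $\mathrm{Int}\,\mathbb D$; the $u_t$ are the holomorphic discs belonging to the filling and $u_t(\partial\mathbb D)$ are their boundary circles. A local filling of $T$ is an embedding $F\colon(-\varepsilon,\varepsilon)\times\mathbb D\to\mathbb C^2$, for some $\varepsilon>0$, such that $F((-\varepsilon,\varepsilon)\times\partial\mathbb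 D)\subset T$ and, for all $t$, $F(t,\cdot)$ is holomorphic on $\mathrm{Int}\,\mathbb D$. A function $H\colon\mathbb C^2\to\mathbb R$ is strictly plurisubharmonic if $-\mathrm d(\mathrm dH\circ\mathrm i)(v,\mathrm iv)>0$ for all non-vanishing tangent vectors $v$ of $\mathbb C^2$. The complex tangencies $\xi=TM\cap\mathrm i\,TM$ form a contact structure on the regular level set $M$. The characteristic foliation $T_\xi$ of $T$ is the foliation integrating the line field $TT\cap\xi$, which is $1$-dimensional since $T$ is totally real; its leaves are called characteristics. A characteristic of a cylinder in $T$ (a leaf of the restriction of $T_\xi$ to the cylinder) is called trapped if it does not connect the two boundary components of the cylinder. *)

theory Defs
  imports "HOL-Complex_Analysis.Complex_Analysis"
begin

section \<open>Smooth maps, immersions, embeddings\<close>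

text \<open>Meaningful for open \<open>U\<close> and maps between finite-dimensional spaces.\<close>

primrec Ck_on :: "nat \<Rightarrow> 'a set \<Rightarrow> ('a::real_normed_vector \<Rightarrow> 'b::real_normed_vector) \<Rightarrow> bool" where
  "Ck_on 0 U f \<longleftrightarrow> continuous_on U f"
| "Ck_on (Suc k) U f \<longleftrightarrow>
     (\<forall>x\<in>U. f differentiable (at x)) \<and>
     (\<forall>v. Ck_on k U (\<lambda>x. frechet_derivative f (at x) v))"

text \<open>Smoothness on an arbitrary subset (e.g.\ up to the boundary of a manifold with boundary)
  means that locally there is a smooth extension to an open set.\<close>

definition smooth_on :: "'a set \<Rightarrow> ('a::real_normed_vector \<Rightarrow> 'b::real_normed_vector) \<Rightarrow> bool" where
  "smooth_on S f \<longleftrightarrow>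
     (\<forall>x\<in>S. \<exists>U g. open U \<and> x \<in> U \<and> (\<forall>k. Ck_on k U g) \<and> (\<forall>y\<in>S \<inter> U. g y = f y))"

text \<open>Only used for \<open>S\<close> open or \<open>S\<close> an open set times the closed disc, where the derivative
  within \<open>S\<close> is unique at every point of \<open>S\<close>, boundary points included.\<close>

definition immersion_on :: "'a set \<Rightarrow> ('a::real_normed_vector \<Rightarrow> 'b::real_normed_vector) \<Rightarrow> bool" where
  "immersion_on S f \<longleftrightarrow>
     smooth_on S f \<and> (\<forall>x\<in>S. inj (frechet_derivative f (at x within S)))"

definition embedding_on :: "'a set \<Rightarrow> ('a::real_normed_vector \<Rightarrow> 'b::real_normed_vector) \<Rightarrow> bool" where
  "embedding_on S f \<longleftrightarrow> immersion_on S f \<and> (\<exists>g. homeomorphism S (f ` S) f g)"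

definition eq_mod_2pi :: "real \<Rightarrow> real \<Rightarrow> bool" where
  "eq_mod_2pi s t \<longleftrightarrow> (\<exists>k::int. s = t + 2 * pi * of_int k)"

section \<open>Tangent spaces and totally real tori\<close>

text \<open>For a smooth embedded submanifold \<open>S\<close> without boundary this is the usual tangent space;
  allowing \<open>C\<^sup>1\<close> instead of smooth curves does not enlarge it.\<close>

definition tangent_space :: "'a::real_normed_vector set \<Rightarrow> 'a \<Rightarrow> 'a set" where
  "tangent_space S p =
     {v. \<exists>\<gamma> \<epsilon>. \<epsilon> > 0 \<and> \<gamma> C1_differentiable_on {-\<epsilon><..<\<epsilon>} \<and> \<gamma> ` {-\<epsilon><..<\<epsilon>} \<subseteq> S \<and>
           \<gamma> 0 = p \<and> (\<gamma> has_vector_derivative v) (at 0)}"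

text \<open>Maps on \<open>\<real>/2\<pi>\<int>\<close> are written as \<open>2\<pi>\<close>-periodic maps on \<open>\<real>\<close>. By compactness of the torus
  an injective immersion of it is an embedding.\<close>

definition embedded_torus :: "(complex^2) set \<Rightarrow> bool" where
  "embedded_torus T \<longleftrightarrow>
     (\<exists>\<phi> :: real \<times> real \<Rightarrow> complex^2.
        immersion_on UNIV \<phi> \<and>
        (\<forall>s t s' t'. \<phi> (s, t) = \<phi> (s', t') \<longleftrightarrow> eq_mod_2pi s s' \<and> eq_mod_2pi t t') \<and>
        T = range \<phi>)"

definition complex_tangencies :: "(complex^2) set \<Rightarrow> complex^2 \<Rightarrow> (complex^2) set" where
  "complex_tangencies S p = tangent_space S p \<inter> (\<lambda>v. \<i> *s v) ` tangent_space S p"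

definition totally_real :: "(complex^2) set \<Rightarrow> bool" where
  "totally_real T \<longleftrightarrow> (\<forall>p\<in>T. complex_tangencies T p = {0})"

section \<open>Strictly plurisubharmonic functions\<close>

text \<open>A one-form \<open>\<alpha>\<close> is given by \<open>\<alpha> p v\<close>; this is the usual formula for its exterior derivative
  on the constant vector fields \<open>v\<close>, \<open>w\<close>.\<close>

definition ext_deriv :: "('a::real_normed_vector \<Rightarrow> 'a \<Rightarrow> real) \<Rightarrow> 'a \<Rightarrow> 'a \<Rightarrow> 'a \<Rightarrow> real" where
  "ext_deriv \<alpha> p v w =
     frechet_derivative (\<lambda>x. \<alpha> x w) (at p) v - frechet_derivative (\<lambda>x. \<alpha> x v) (at p) w"

definition strictly_psh :: "(complex^2 \<Rightarrow> real) \<Rightarrow> bool" where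
  "strictly_psh H \<longleftrightarrow>
     (\<forall>p v. v \<noteq> 0 \<longrightarrow> - ext_deriv (\<lambda>x u. frechet_derivative H (at x) (\<i> *s u)) p v (\<i> *s v) > 0)"

definition regular_value :: "(complex^2 \<Rightarrow> real) \<Rightarrow> real \<Rightarrow> bool" where
  "regular_value H c \<longleftrightarrow> (\<forall>p. H p = c \<longrightarrow> surj (frechet_derivative H (at p)))"

section \<open>Fillings by holomorphic discs\<close>

definition holomorphic_disc :: "(complex \<Rightarrow> complex^2) \<Rightarrow> bool" where
  "holomorphic_disc u \<longleftrightarrow> (\<forall>k. (\<lambda>z. u z $ k) holomorphic_on ball 0 1)"

text \<open>As for tori, \<open>F\<close> is the lift to \<open>\<real> \<times> \<D>\<close> of a map on \<open>S\<^sup>1 \<times> \<D>\<close>, which is an embedding iff it is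
  an injective immersion, by compactness. Values of \<open>F\<close> outside \<open>\<real> \<times> \<D>\<close> are irrelevant.\<close>

definition analytic_filling :: "(complex^2) set \<Rightarrow> (real \<times> complex \<Rightarrow> complex^2) \<Rightarrow> bool" where
  "analytic_filling T F \<longleftrightarrow>
     immersion_on (UNIV \<times> cball 0 1) F \<and>
     (\<forall>s t. \<forall>z\<in>cball 0 1. \<forall>w\<in>cball 0 1.
        F (s, z) = F (t, w) \<longleftrightarrow> eq_mod_2pi s t \<and> z = w) \<and>
     F ` (UNIV \<times> sphere 0 1) = T \<and>
     (\<forall>t. holomorphic_disc (\<lambda>z. F (t, z)))"

definition local_filling :: "(complex^2) set \<Rightarrow> real \<Rightarrow> (real \<times> complex \<Rightarrow> complex^2) \<Rightarrow> bool" where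
  "local_filling T \<epsilon> F \<longleftrightarrow>
     \<epsilon> > 0 \<and>
     embedding_on ({-\<epsilon><..<\<epsilon>} \<times> cball 0 1) F \<and>
     F ` ({-\<epsilon><..<\<epsilon>} \<times> sphere 0 1) \<subseteq> T \<and>
     (\<forall>t\<in>{-\<epsilon><..<\<epsilon>}. holomorphic_disc (\<lambda>z. F (t, z)))"

section \<open>The characteristic foliation\<close>

definition char_line :: "(complex^2) set \<Rightarrow> (complex^2) set \<Rightarrow> complex^2 \<Rightarrow> (complex^2) set" where
  "char_line M T p = tangent_space T p \<inter> complex_tangencies M p"

text \<open>The pullback, along the restriction of \<open>F\<close> to \<open>\<real> \<times> \<partial>\<D>\<close>, of a line field \<open>L\<close>. Since \<open>F\<close> is
  smooth on \<open>\<real> \<times> \<D>\<close>, the differential can be computed there.\<close>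

definition pullback_line ::
    "(real \<times> complex \<Rightarrow> complex^2) \<Rightarrow> (complex^2 \<Rightarrow> (complex^2) set) \<Rightarrow>
     real \<times> complex \<Rightarrow> (real \<times> complex) set" where
  "pullback_line F L p =
     {w \<in> tangent_space (UNIV \<times> sphere 0 1) p.
        frechet_derivative F (at p within UNIV \<times> cball 0 1) w \<in> L (F p)}"

text \<open>The leaves in \<open>C\<close> of the foliation integrating a smooth line field \<open>L\<close> are the equivalence
  classes of the relation of being joined by a \<open>C\<^sup>1\<close> curve in \<open>C\<close> that is everywhere tangent to \<open>L\<close>.
  If \<open>C\<close> has boundary these are the path components, in the leaf topology, of the intersections
  of leaves with \<open>C\<close>. The curve may have zero velocity; smooth curves would give the same classes.\<close>

definition leaf_through :: "'a::real_normed_vector set \<Rightarrow> ('a \<Rightarrow> 'a set) \<Rightarrow> 'a \<Rightarrow> 'a set" where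
  "leaf_through C L p =
     {q. \<exists>\<gamma>. \<gamma> C1_differentiable_on {0..1} \<and> \<gamma> ` {0..1} \<subseteq> C \<and> \<gamma> 0 = p \<and> \<gamma> 1 = q \<and>
          (\<forall>s\<in>{0..1}. vector_derivative \<gamma> (at s) \<in> L (\<gamma> s))}"

definition leaves :: "'a::real_normed_vector set \<Rightarrow> ('a \<Rightarrow> 'a set) \<Rightarrow> 'a set set" where
  "leaves C L = leaf_through C L ` C"

definition cylinder :: "real \<Rightarrow> real \<Rightarrow> (real \<times> complex) set" where
  "cylinder a b = {a..b} \<times> sphere 0 1"

text \<open>Working on the parametrizing cylinder rather than on its image in \<open>T\<close> keeps the two boundary
  components apart when \<open>b = a + 2\<pi>\<close>.\<close>

definition cylinder_characteristics ::
    "(complex^2) set \<Rightarrow> (complex^2) set \<Rightarrow> (real \<times> complex \<Rightarrow> complex^2) \<Rightarrow> real \<Rightarrow> real \<Rightarrow>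
     (real \<times> complex) set set" where
  "cylinder_characteristics M T F a b =
     leaves (cylinder a b) (pullback_line F (char_line M T))"

definition trapped :: "real \<Rightarrow> real \<Rightarrow> (real \<times> complex) set \<Rightarrow> bool" where
  "trapped a b l \<longleftrightarrow>
     \<not> (l \<inter> ({a} \<times> sphere 0 1) \<noteq> {} \<and> l \<inter> ({b} \<times> sphere 0 1) \<noteq> {})"

end

theory Submission
  imports Defs
begin

text \<open>
  The boundary circles of the discs are positively transverse to the contact structure, and
  this forces every characteristic to be a graph over the parameter \<open>t\<close> of the filling.

  Let \<open>u = F(t, \<cdot>)\<close> be one of the discs. Then \<open>H \<circ> u\<close> is strictly subharmonic because \<open>H\<close> is
  strictly plurisubharmonic and \<open>u\<close> is an immersion, and it is equal to \<open>c\<close> on the boundary circle.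
  By the Hopf boundary lemma its outer normal derivative \<open>dH(z u'(z))\<close> is positive at every
  boundary point (\<open>disc_boundary_derivative_pos\<close>). Since the velocity of the boundary circle is
  \<open>\<i> z u'(z)\<close>, this normal derivative is the value on it of the contact form \<open>-dH \<circ> \<i>\<close>, whose
  kernel in \<open>TM\<close> is the field of complex tangencies. So on the cylinder with coordinates
  \<open>(t, \<theta>)\<close> the characteristic foliation is the kernel of a form \<open>f dt + g d\<theta>\<close> with \<open>g > 0\<close>: it is the
  graph of the slope field \<open>h = - f / g\<close> (\<open>characteristic_slope\<close>), which is locally Lipschitz and
  periodic in \<open>\<theta>\<close>. The equation \<open>d\<theta>/dt = h t \<theta>\<close> has solutions for all times
  (\<open>global_Picard_Lindeloef\<close>), and following such a solution from any point of the cylinder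
  reaches both boundary components (\<open>leaf_reaches_every_level\<close>).

  That the pulled back line field contains the directions \<open>(1, h)\<close> also requires the tangent
  space of \<open>M\<close> to be as large as the kernel of \<open>dH\<close> (\<open>kernel_subset_tangent_level_set\<close>), which is
  where regularity of the value \<open>c\<close> enters.
\<close>

section \<open>Global solutions of ordinary differential equations\<close>

lemma ex_antiderivative:
  fixes f :: "real \<Rightarrow> 'a::euclidean_space"
  assumes "continuous_on UNIV f"
  obtains g where "g 0 = y" "\<And>t. (g has_vector_derivative f t) (at t)"
proof -
  have "\<exists>G. \<forall>x::real. -\<infinity> < ereal x \<longrightarrow> ereal x < \<infinity> \<longrightarrow> (G has_vector_derivative f x) (at x)"
    using assms by (intro einterval_antiderivative) (auto simp: continuous_on_eq_continuous_at)
  then obtain G where G: "\<And>t. (G has_vector_derivative f t) (at t)"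
    by auto
  show thesis
  proof (rule that[of "\<lambda>t. G t - G 0 + y"])
    show "((\<lambda>t. G t - G 0 + y) has_vector_derivative f t) (at t)" for t
      by (auto intro!: derivative_eq_intros G)
  qed simp
qed

lemma continuous_on_of_vector_derivative:
  assumes "\<And>t. (f has_vector_derivative f' t) (at t)"
  shows "continuous_on S f"
  by (intro continuous_at_imp_continuous_on ballI has_vector_derivative_continuous[OF assms])

lemma norm_le_of_derivative_le_nonneg:
  fixes f :: "real \<Rightarrow> 'a::euclidean_space"
  assumes f: "\<And>s. (f has_vector_derivative f' s) (at s)" and f0: "f 0 = 0"
    and \<phi>: "\<And>s. (\<phi> has_vector_derivative \<phi>' s) (at s)" and \<phi>0: "0 \<le> \<phi> 0"
    and le: "\<And>s. 0 \<le> s \<Longrightarrow> s \<le> t \<Longrightarrow> norm (f' s) \<le> \<phi>' s" and t: "0 \<le> t"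
  shows "norm (f t) \<le> \<phi> t"
proof (cases "t = 0")
  case True
  then show ?thesis using f0 \<phi>0 by simp
next
  case False
  have "norm (f t - f 0) \<le> \<phi> t - \<phi> 0"
  proof (rule differentiable_bound_general[where f' = f' and \<phi>' = \<phi>'])
    show "continuous_on {0..t} f" "continuous_on {0..t} \<phi>"
      by (rule continuous_on_of_vector_derivative, rule f)
        (rule continuous_on_of_vector_derivative, rule \<phi>)
    show "0 < t" using False t by simp
    show "(f has_vector_derivative f' s) (at s)" "(\<phi> has_vector_derivative \<phi>' s) (at s)" for s
      by (rule f, rule \<phi>)
    show "norm (f' s) \<le> \<phi>' s" if "0 < s" "s < t" for s
      using le that by simp
  qed
  then show ?thesis using f0 \<phi>0 by simp
qed

text \<open>Reflecting \<open>s \<mapsto> - s\<close> reduces negative \<open>t\<close> to the preceding estimate; this is what allows one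
  estimate to serve both time directions in the Picard iteration.\<close>

lemma norm_le_of_derivative_le:
  fixes f :: "real \<Rightarrow> 'a::euclidean_space"
  assumes f: "\<And>s. (f has_vector_derivative f' s) (at s)" and f0: "f 0 = 0"
    and \<phi>: "\<And>s. (\<phi> has_vector_derivative \<phi>' s) (at s)" and \<phi>0: "0 \<le> \<phi> 0"
    and le: "\<And>s. \<bar>s\<bar> \<le> \<bar>t\<bar> \<Longrightarrow> norm (f' s) \<le> \<phi>' \<bar>s\<bar>"
  shows "norm (f t) \<le> \<phi> \<bar>t\<bar>"
proof (cases "0 \<le> t")
  case True
  have "norm (f' s) \<le> \<phi>' s" if "0 \<le> s" "s \<le> t" for s
    using le[of s] that by simp
  from norm_le_of_derivative_le_nonneg[OF f f0 \<phi> \<phi>0 this True] True show ?thesis by simp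
next
  case False
  have "((\<lambda>s. f (- s)) has_vector_derivative (- f' (- s))) (at s)" for s
  proof -
    have "(uminus has_vector_derivative (-1::real)) (at s)"
      by (auto intro!: derivative_eq_intros)
    from vector_diff_chain_at[OF this f[of "- s"]] show ?thesis
      by (simp add: o_def)
  qed
  note deriv = this
  have "norm (- f' (- s)) \<le> \<phi>' s" if "0 \<le> s" "s \<le> - t" for s
    using le[of "- s"] that by simp
  then have "norm (f (- (- t))) \<le> \<phi> (- t)"
    by (intro norm_le_of_derivative_le_nonneg[OF deriv _ \<phi> \<phi>0]) (use False f0 in auto)
  then show ?thesis using False by simp
qed

text \<open>Picard iteration. A Lipschitz constant that may grow with \<open>\<bar>t\<bar>\<close> suffices for solutions that exist
  for all time, because the iterates converge uniformly on every \<open>{-R..R}\<close> whatever the constant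
  there is. The limit \<open>x\<close> is shown to solve the equation by comparing it with the primitive \<open>Y\<close> of
  \<open>t \<mapsto> h t (x t)\<close>: the iterates converge to \<open>Y\<close> as well.\<close>

theorem global_Picard_Lindeloef:
  fixes h :: "real \<Rightarrow> 'a::euclidean_space \<Rightarrow> 'a"
  assumes cont: "continuous_on UNIV (\<lambda>(t, x). h t x)"
    and lip: "\<And>R. \<exists>K. \<forall>t. \<bar>t\<bar> \<le> R \<longrightarrow> K-lipschitz_on UNIV (h t)"
  obtains x where "x 0 = y" "\<And>t. (x has_vector_derivative h t (x t)) (at t)"
proof -
  have conth: "continuous_on UNIV (\<lambda>t. h t (x t))" if "continuous_on UNIV x" for x
  proof -
    have "continuous_on UNIV (\<lambda>t. (t, x t))"
      by (intro continuous_intros that)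
    from continuous_on_compose2[OF cont this] show ?thesis by simp
  qed
  have ex: "\<exists>Y. Y 0 = y \<and> (\<forall>t. (Y has_vector_derivative h t (x t)) (at t))"
    if "continuous_on UNIV x" for x
    using ex_antiderivative[OF conth[OF that], of y] by blast
  have "\<exists>X. \<forall>n. (continuous_on UNIV (X n) \<and> X n 0 = y)
        \<and> (\<forall>t. (X (Suc n) has_vector_derivative h t (X n t)) (at t))"
  proof (rule dependent_nat_choice)
    show "\<exists>x. continuous_on UNIV x \<and> x 0 = y"
      by (intro exI[of _ "\<lambda>_. y"]) auto
  next
    fix x :: "real \<Rightarrow> 'a" and n :: nat
    assume "continuous_on UNIV x \<and> x 0 = y"
    then obtain Y where Y: "Y 0 = y" "\<And>t. (Y has_vector_derivative h t (x t)) (at t)"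
      using ex[of x] by blast
    show "\<exists>Y. (continuous_on UNIV Y \<and> Y 0 = y)
        \<and> (\<forall>t. (Y has_vector_derivative h t (x t)) (at t))"
      by (intro exI[of _ Y] conjI allI Y continuous_on_of_vector_derivative[of Y "\<lambda>t. h t (x t)"])
  qed
  then obtain X where X: "\<forall>n. (continuous_on UNIV (X n) \<and> X n 0 = y)
        \<and> (\<forall>t. (X (Suc n) has_vector_derivative h t (X n t)) (at t))"
    by (rule exE)
  have Xc: "continuous_on UNIV (X n)" and X0: "X n 0 = y"
    and Xd: "(X (Suc n) has_vector_derivative h t (X n t)) (at t)" for n t
    using spec[OF X, of n] by auto
  \<comment> \<open>In the weighted norm with weight \<open>exp (2 K \<bar>t\<bar>)\<close>, integrating against \<open>K\<close> gains a factor
    \<open>1/2\<close> on the whole interval, so the iterates converge geometrically.\<close>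
  have est: "\<exists>C K. 0 < K \<and> 0 \<le> C \<and> (\<forall>t. \<bar>t\<bar> \<le> R \<longrightarrow> K-lipschitz_on UNIV (h t)) \<and>
      (\<forall>n t. \<bar>t\<bar> \<le> R \<longrightarrow> norm (X (Suc n) t - X n t) \<le> C * exp (2 * K * \<bar>t\<bar>) * (1/2)^n)" for R
  proof -
    obtain K0 where K0: "\<And>t. \<bar>t\<bar> \<le> R \<Longrightarrow> K0-lipschitz_on UNIV (h t)"
      using lip by blast
    define K where "K = max K0 1"
    have K: "0 < K" and Kl: "\<And>t. \<bar>t\<bar> \<le> R \<Longrightarrow> K-lipschitz_on UNIV (h t)"
      using K0 lipschitz_on_mono[OF K0 subset_refl] by (auto simp: K_def)
    have "bounded ((\<lambda>t. X 1 t - X 0 t) ` {-R..R})"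
      by (intro compact_imp_bounded compact_continuous_image continuous_on_diff continuous_on_subset[OF Xc]) auto
    then obtain C where C: "0 < C" "\<forall>v\<in>(\<lambda>t. X 1 t - X 0 t) ` {-R..R}. norm v \<le> C"
      unfolding bounded_pos by (elim exE conjE)
    have C': "norm (X 1 t - X 0 t) \<le> C" if "\<bar>t\<bar> \<le> R" for t
      using C(2) that by (simp add: abs_le_iff)
    have "norm (X (Suc n) t - X n t) \<le> C * exp (2 * K * \<bar>t\<bar>) * (1/2)^n" if "\<bar>t\<bar> \<le> R" for n t
      using that
    proof (induction n arbitrary: t)
      case 0
      have "norm (X 1 t - X 0 t) \<le> C" using C'[OF 0] .
      also have "\<dots> \<le> C * exp (2 * K * \<bar>t\<bar>)"
        using \<open>0 < C\<close> K mult_left_mono[of 1 "exp (2 * K * \<bar>t\<bar>)" C] by simp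
      finally show ?case by simp
    next
      case (Suc n)
      show ?case
      proof (rule norm_le_of_derivative_le[where f = "\<lambda>t. X (Suc (Suc n)) t - X (Suc n) t"
            and \<phi> = "\<lambda>s. C * exp (2 * K * s) * (1/2)^Suc n"
            and \<phi>' = "\<lambda>s. K * (C * exp (2 * K * s) * (1/2)^n)"
            and f' = "\<lambda>t. h t (X (Suc n) t) - h t (X n t)"])
        fix s
        show "((\<lambda>t. X (Suc (Suc n)) t - X (Suc n) t) has_vector_derivative
            h s (X (Suc n) s) - h s (X n s)) (at s)"
          by (intro derivative_intros Xd)
        show "((\<lambda>s. C * exp (2 * K * s) * (1/2)^Suc n) has_vector_derivative
            K * (C * exp (2 * K * s) * (1/2)^n)) (at s)"
          unfolding has_real_derivative_iff_has_vector_derivative[symmetric]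
          by (auto intro!: derivative_eq_intros)
        assume s: "\<bar>s\<bar> \<le> \<bar>t\<bar>"
        have "norm (h s (X (Suc n) s) - h s (X n s)) \<le> K * norm (X (Suc n) s - X n s)"
          using lipschitz_onD[OF Kl[of s], of "X (Suc n) s" "X n s"] s Suc.prems
          by (simp add: dist_norm)
        also have "\<dots> \<le> K * (C * exp (2 * K * \<bar>s\<bar>) * (1/2)^n)"
          using Suc.IH[of s] s Suc.prems K by (intro mult_left_mono) auto
        finally show "norm (h s (X (Suc n) s) - h s (X n s))
            \<le> K * (C * exp (2 * K * \<bar>s\<bar>) * (1/2)^n)" .
      qed (use X0 \<open>0 < C\<close> in auto)
    qed
    then show ?thesis using K Kl \<open>0 < C\<close> by (intro exI[of _ C] exI[of _ K]) auto
  qed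
  have "\<exists>x. \<forall>R. uniform_limit {-R..R} X x sequentially"
  proof -
    have uc: "uniformly_convergent_on {-R..R} X" for R
    proof -
      obtain C K where CK: "0 < K" "0 \<le> C"
        "\<And>n t. \<bar>t\<bar> \<le> R \<Longrightarrow> norm (X (Suc n) t - X n t) \<le> C * exp (2 * K * \<bar>t\<bar>) * (1/2)^n"
        using est[of R] by blast
      have "uniformly_convergent_on {-R..R} (\<lambda>n t. \<Sum>i<n. X (Suc i) t - X i t)"
      proof (rule Weierstrass_m_test')
        fix n t assume "t \<in> {-R..R}"
        then have t: "\<bar>t\<bar> \<le> R" by auto
        have "norm (X (Suc n) t - X n t) \<le> C * exp (2 * K * \<bar>t\<bar>) * (1/2)^n"
          using CK(3)[OF t] .
        also have "\<dots> \<le> C * exp (2 * K * R) * (1/2)^n"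
          using t CK by (intro mult_right_mono mult_left_mono) auto
        finally show "norm (X (Suc n) t - X n t) \<le> C * exp (2 * K * R) * (1/2)^n" .
      next
        show "summable (\<lambda>n. C * exp (2 * K * R) * (1/2)^n :: real)"
          by (intro summable_mult summable_geometric) auto
      qed
      then obtain l where l: "uniform_limit {-R..R} (\<lambda>n t. \<Sum>i<n. X (Suc i) t - X i t) l sequentially"
        by (auto simp: uniformly_convergent_on_def)
      have "uniform_limit {-R..R} (\<lambda>n t. (\<Sum>i<n. X (Suc i) t - X i t) + X 0 t)
          (\<lambda>t. l t + X 0 t) sequentially"
        by (intro uniform_limit_intros l)
      moreover have "(\<Sum>i<n. X (Suc i) t - X i t) + X 0 t = X n t" for n t
        using sum_lessThan_telescope[of "\<lambda>i. X i t" n] by simp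
      ultimately show ?thesis
        unfolding uniformly_convergent_on_def by (intro exI[of _ "\<lambda>t. l t + X 0 t"]) simp
    qed
    define x where "x t = lim (\<lambda>n. X n t)" for t
    have "uniform_limit {-R..R} X x sequentially" for R
      using uniformly_convergent_uniform_limit_iff[THEN iffD1, OF uc[of R]]
      by (simp add: x_def[abs_def])
    then show ?thesis by blast
  qed
  then obtain x where x: "\<And>R. uniform_limit {-R..R} X x sequentially"
    by blast
  have xl: "(\<lambda>n. X n t) \<longlonglongrightarrow> x t" for t
    by (rule tendsto_uniform_limitI[OF x[of "\<bar>t\<bar>"]]) auto
  have xc: "continuous_on UNIV x"
  proof -
    have "isCont x t" for t
    proof -
      have "continuous_on {-(\<bar>t\<bar>+1)..\<bar>t\<bar>+1} x"
        by (rule uniform_limit_theorem[OF _ x])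
          (simp_all add: continuous_on_subset[OF Xc subset_UNIV])
      moreover have "t \<in> interior {-(\<bar>t\<bar>+1)..\<bar>t\<bar>+1}"
        by (simp add: interior_atLeastAtMost_real) linarith
      ultimately show ?thesis
        by (rule continuous_on_interior)
    qed
    then show ?thesis by (simp add: continuous_on_eq_continuous_at)
  qed
  obtain Y where Y0: "Y 0 = y" and Y: "\<And>t. (Y has_vector_derivative h t (x t)) (at t)"
    using ex[OF xc] by blast
  have "Y t = x t" for t
  proof -
    obtain K where K: "K > 0" "\<And>s. \<bar>s\<bar> \<le> \<bar>t\<bar> \<Longrightarrow> K-lipschitz_on UNIV (h s)"
      using est[of "\<bar>t\<bar>"] by blast
    have "(\<lambda>n. X (Suc n) t) \<longlonglongrightarrow> Y t"
    proof (rule metric_LIMSEQ_I)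
      fix e :: real assume e: "0 < e"
      define D where "D = K * (\<bar>t\<bar> + 1)"
      have D: "0 < D" unfolding D_def by (rule mult_pos_pos[OF K(1)]) simp
      define e' where "e' = e / (2 * D)"
      have e': "0 < e'" using e D by (simp add: e'_def)
      obtain N where N': "\<forall>n\<ge>N. \<forall>s\<in>{-\<bar>t\<bar>..\<bar>t\<bar>}. dist (X n s) (x s) < e'"
        using uniform_limitD[OF x[of "\<bar>t\<bar>"] e'] unfolding eventually_sequentially by (elim exE)
      have N: "dist (X n s) (x s) < e'" if "n \<ge> N" "\<bar>s\<bar> \<le> \<bar>t\<bar>" for n s
      proof -
        have "s \<in> {-\<bar>t\<bar>..\<bar>t\<bar>}" using that(2) by auto
        then show ?thesis using N' that(1) by blast
      qed
      have "dist (X (Suc n) t) (Y t) < e" if "n \<ge> N" for n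
      proof -
        have "norm (X (Suc n) t - Y t) \<le> (K * e') * \<bar>t\<bar>"
        proof (rule norm_le_of_derivative_le[where f = "\<lambda>t. X (Suc n) t - Y t"
              and \<phi> = "\<lambda>s. (K * e') * s" and \<phi>' = "\<lambda>s. K * e'"
              and f' = "\<lambda>t. h t (X n t) - h t (x t)"])
          fix s
          show "((\<lambda>t. X (Suc n) t - Y t) has_vector_derivative h s (X n s) - h s (x s)) (at s)"
            by (intro derivative_intros Xd Y)
          show "((\<lambda>s. (K * e') * s) has_vector_derivative K * e') (at s)"
            unfolding has_real_derivative_iff_has_vector_derivative[symmetric]
            by (auto intro!: derivative_eq_intros)
          assume s: "\<bar>s\<bar> \<le> \<bar>t\<bar>"
          have "norm (h s (X n s) - h s (x s)) \<le> K * dist (X n s) (x s)"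
            using lipschitz_onD[OF K(2)[OF s], of "X n s" "x s"] by (simp add: dist_norm)
          also have "\<dots> \<le> K * e'"
            using N[OF that s] K by (intro mult_left_mono) auto
          finally show "norm (h s (X n s) - h s (x s)) \<le> K * e'" .
        qed (use X0 Y0 in auto)
        also have "\<dots> \<le> (K * e') * (\<bar>t\<bar> + 1)" using K e' by (intro mult_left_mono) auto
        also have "\<dots> = e' * D" by (simp only: D_def mult_ac)
        also have "\<dots> = e / 2" using D by (simp add: e'_def)
        also have "\<dots> < e" using e by simp
        finally show ?thesis by (simp add: dist_norm)
      qed
      then show "\<exists>N. \<forall>n\<ge>N. dist (X (Suc n) t) (Y t) < e" by blast
    qed
    moreover have "(\<lambda>n. X (Suc n) t) \<longlonglongrightarrow> x t"
      using LIMSEQ_Suc[OF xl] .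
    ultimately show ?thesis by (rule LIMSEQ_unique)
  qed
  then have "Y = x" by (rule ext)
  show thesis
    using that[of x] Y0 Y unfolding \<open>Y = x\<close> by iprover
qed

section \<open>Local Lipschitz continuity\<close>

text \<open>The ODE of the characteristics is built from derivatives of \<open>H\<close> and \<open>F\<close> by compositions, products
  and a quotient. A Lipschitz condition near a single point passes through these operations with
  no domains to keep track of, and it yields both continuity and, by compactness, the uniform
  bounds that Picard iteration asks for.\<close>

definition loclip_at :: "('a::metric_space \<Rightarrow> 'b::metric_space) \<Rightarrow> 'a \<Rightarrow> bool" where
  "loclip_at f p \<longleftrightarrow> (\<exists>e>0. \<exists>L. L-lipschitz_on (ball p e) f)"

lemma loclip_at_cong:
  assumes "loclip_at g p" "open V" "p \<in> V" "\<And>x. x \<in> V \<Longrightarrow> f x = g x"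
  shows "loclip_at f p"
proof -
  obtain e L where e: "e > 0" "L-lipschitz_on (ball p e) g"
    using assms(1) by (auto simp: loclip_at_def)
  obtain d where d: "d > 0" "ball p d \<subseteq> V"
    using assms(2,3) openE by blast
  have "L-lipschitz_on (ball p (min d e)) g"
    by (rule lipschitz_on_subset[OF e(2)]) auto
  then have "L-lipschitz_on (ball p (min d e)) f"
    by (rule lipschitz_on_transform) (use d(2) assms(4) in auto)
  then show ?thesis
    using e(1) d(1) unfolding loclip_at_def by (intro exI[of _ "min d e"]) auto
qed

lemma loclip_at_isCont: "loclip_at f p \<Longrightarrow> isCont f p"
proof -
  assume "loclip_at f p"
  then obtain e L where e: "e > 0" "L-lipschitz_on (ball p e) f"
    by (auto simp: loclip_at_def)
  have "continuous_on (ball p e) f"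
    by (rule lipschitz_on_continuous_on[OF e(2)])
  then show ?thesis
    using e(1) by (simp add: continuous_on_eq_continuous_at)
qed

lemma loclip_at_compose:
  assumes g: "loclip_at g p" and f: "loclip_at f (g p)"
  shows "loclip_at (\<lambda>x. f (g x)) p"
proof -
  obtain e L where e: "e > 0" "L-lipschitz_on (ball p e) g"
    using g by (auto simp: loclip_at_def)
  obtain d M where d: "d > 0" "M-lipschitz_on (ball (g p) d) f"
    using f by (auto simp: loclip_at_def)
  obtain r where r: "r > 0" "\<And>x. dist x p < r \<Longrightarrow> dist (g x) (g p) < d"
    using loclip_at_isCont[OF g] d(1) unfolding continuous_at_eps_delta by metis
  have "L-lipschitz_on (ball p (min e r)) g"
    by (rule lipschitz_on_subset[OF e(2)]) auto
  moreover have "M-lipschitz_on (g ` ball p (min e r)) f"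
    by (rule lipschitz_on_subset[OF d(2)]) (use r(2) in \<open>auto simp: dist_commute\<close>)
  ultimately have "(M * L)-lipschitz_on (ball p (min e r)) (\<lambda>x. f (g x))"
    by (rule lipschitz_on_compose2)
  then show ?thesis
    using e(1) r(1) unfolding loclip_at_def by (intro exI[of _ "min e r"]) auto
qed

lemma loclip_at_Pair:
  assumes f: "loclip_at f p" and g: "loclip_at g p"
  shows "loclip_at (\<lambda>x. (f x, g x)) p"
proof -
  obtain e L where e: "e > 0" "L-lipschitz_on (ball p e) f"
    using f by (auto simp: loclip_at_def)
  obtain d M where d: "d > 0" "M-lipschitz_on (ball p d) g"
    using g by (auto simp: loclip_at_def)
  have "L-lipschitz_on (ball p (min e d)) f" "M-lipschitz_on (ball p (min e d)) g"
    by (rule lipschitz_on_subset[OF e(2)] lipschitz_on_subset[OF d(2)]; auto)+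
  from lipschitz_on_Pair[OF this] show ?thesis
    using e(1) d(1) unfolding loclip_at_def by (intro exI[of _ "min e d"]) auto
qed

lemma loclip_at_bounded_linear:
  assumes "bounded_linear f" shows "loclip_at f p"
proof -
  obtain B where "B-lipschitz_on UNIV f"
    using bounded_linear.lipschitz_boundE[OF assms] by metis
  then have "B-lipschitz_on (ball p 1) f"
    by (rule lipschitz_on_subset) simp
  then show ?thesis
    unfolding loclip_at_def by (intro exI[of _ 1] conjI exI[of _ B]) auto
qed

lemma loclip_at_const: "loclip_at (\<lambda>_. c) p"
  unfolding loclip_at_def using lipschitz_on_constant[of "ball p 1" c] zero_less_one by blast

text \<open>On a compact ball the directional derivatives along the basis are bounded, which bounds the
  operator norm of the derivative.\<close>

lemma loclip_at_C1:
  fixes f :: "'a::euclidean_space \<Rightarrow> 'b::real_normed_vector"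
  assumes U: "open U" "p \<in> U" and f: "Ck_on (Suc 0) U f"
  shows "loclip_at f p"
proof -
  obtain e where e: "e > 0" "cball p e \<subseteq> U"
    using U open_contains_cball by blast
  have df: "(f has_derivative frechet_derivative f (at x)) (at x)" if "x \<in> cball p e" for x
    using f e(2) that by (auto simp: frechet_derivative_works[symmetric])
  have "bounded ((\<lambda>x. frechet_derivative f (at x) b) ` cball p e)" for b
    using f e(2) by (intro compact_imp_bounded compact_continuous_image)
      (auto intro: continuous_on_subset)
  then have "\<exists>B. \<forall>x\<in>cball p e. norm (frechet_derivative f (at x) b) \<le> B" for b
    unfolding bounded_iff by simp
  then obtain B where B: "\<And>b x. x \<in> cball p e \<Longrightarrow> norm (frechet_derivative f (at x) b) \<le> B b"
    by metis
  have "(\<Sum>b\<in>Basis. B b)-lipschitz_on (cball p e) f"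
  proof (rule bounded_derivative_imp_lipschitz)
    show "(f has_derivative frechet_derivative f (at x)) (at x within cball p e)"
      if "x \<in> cball p e" for x
      using df[OF that] by (rule has_derivative_at_withinI)
    show "convex (cball p e)" by simp
    show "onorm (frechet_derivative f (at x)) \<le> (\<Sum>b\<in>Basis. B b)" if x: "x \<in> cball p e" for x
    proof (rule onorm_le)
      interpret bounded_linear "frechet_derivative f (at x)"
        using df[OF x] by (rule has_derivative_bounded_linear)
      fix v :: 'a
      have "frechet_derivative f (at x) v
          = frechet_derivative f (at x) (\<Sum>b\<in>Basis. (v \<bullet> b) *\<^sub>R b)"
        by (simp add: euclidean_representation)
      also have "\<dots> = (\<Sum>b\<in>Basis. (v \<bullet> b) *\<^sub>R frechet_derivative f (at x) b)"
        by (simp add: sum scaleR)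
      also have "norm \<dots> \<le> (\<Sum>b\<in>Basis. norm v * B b)"
        using B[OF x] by (intro sum_norm_le) (auto intro!: mult_mono simp: Basis_le_norm)
      finally show "norm (frechet_derivative f (at x) v) \<le> (\<Sum>b\<in>Basis. B b) * norm v"
        by (simp add: sum_distrib_left mult.commute)
    qed
    have "0 \<le> B b" for b using order_trans[OF norm_ge_zero B[of p b]] e(1) by simp
    then show "0 \<le> (\<Sum>b\<in>Basis. B b)" by (simp add: sum_nonneg)
  qed
  then have "(\<Sum>b\<in>Basis. B b)-lipschitz_on (ball p e) f"
    by (rule lipschitz_on_subset) auto
  then show ?thesis using e(1) unfolding loclip_at_def by blast
qed

lemma loclip_at_bounded_linear_compose:
  assumes "bounded_linear f" "loclip_at g p" shows "loclip_at (\<lambda>x. f (g x)) p"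
  using assms loclip_at_compose loclip_at_bounded_linear by blast

lemma loclip_at_add:
  fixes f g :: "_ \<Rightarrow> 'b::real_normed_vector"
  assumes "loclip_at f p" "loclip_at g p" shows "loclip_at (\<lambda>x. f x + g x) p"
  using loclip_at_bounded_linear_compose[OF bounded_linear_add[OF bounded_linear_fst bounded_linear_snd]
      loclip_at_Pair[OF assms]] by simp

lemma loclip_at_sum:
  fixes f :: "'i \<Rightarrow> _ \<Rightarrow> 'b::real_normed_vector"
  assumes "finite I" "\<And>i. i \<in> I \<Longrightarrow> loclip_at (f i) p"
  shows "loclip_at (\<lambda>x. \<Sum>i\<in>I. f i x) p"
  using assms
proof (induction I)
  case empty
  show ?case using loclip_at_const[of 0 p] by simp
next
  case (insert i I)
  then have "loclip_at (\<lambda>x. f i x + (\<Sum>i\<in>I. f i x)) p"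
    by (intro loclip_at_add) simp_all
  then show ?case using insert.hyps by simp
qed

lemma loclip_at_scaleR:
  fixes f :: "_ \<Rightarrow> real" and g :: "_ \<Rightarrow> 'b::real_normed_vector"
  assumes f: "loclip_at f p" and g: "loclip_at g p"
  shows "loclip_at (\<lambda>x. f x *\<^sub>R g x) p"
proof -
  have "loclip_at (\<lambda>z. fst z *\<^sub>R snd z :: 'b) (f p, g p)"
  proof -
    define B where "B = max (\<bar>f p\<bar>) (norm (g p)) + 1"
    have "(2 * B)-lipschitz_on (ball (f p, g p) 1) (\<lambda>z. fst z *\<^sub>R snd z)"
    proof (rule lipschitz_onI)
      fix z w assume "z \<in> ball (f p, g p) 1" "w \<in> ball (f p, g p) 1"
      then have "dist (f p) (fst z) < 1" "dist (g p) (snd w) < 1"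
        using dist_fst_le[of "(f p, g p)" z] dist_snd_le[of "(f p, g p)" w] by auto
      then have z: "\<bar>fst z\<bar> \<le> B" and w: "norm (snd w) \<le> B"
        using norm_triangle_ineq2[of "snd w" "g p"]
        by (auto simp: B_def dist_norm norm_minus_commute)
      have "fst z *\<^sub>R snd z - fst w *\<^sub>R snd w
          = fst z *\<^sub>R (snd z - snd w) + (fst z - fst w) *\<^sub>R snd w"
        by (simp add: algebra_simps)
      then have "dist (fst z *\<^sub>R snd z) (fst w *\<^sub>R snd w)
          \<le> \<bar>fst z\<bar> * norm (snd z - snd w) + \<bar>fst z - fst w\<bar> * norm (snd w)"
        by (metis dist_norm norm_scaleR norm_triangle_ineq)
      also have "\<dots> \<le> B * dist z w + dist z w * B"
      proof (intro add_mono mult_mono)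
        show "norm (snd z - snd w) \<le> dist z w" "\<bar>fst z - fst w\<bar> \<le> dist z w"
          using dist_snd_le[of z w] dist_fst_le[of z w] by (auto simp: dist_norm)
      qed (use z w in \<open>auto intro: order_trans[OF norm_ge_zero]\<close>)
      finally show "dist (fst z *\<^sub>R snd z) (fst w *\<^sub>R snd w) \<le> (2 * B) * dist z w"
        by simp
    next
      show "0 \<le> 2 * B" by (simp add: B_def le_max_iff_disj add_nonneg_nonneg)
    qed
    then show ?thesis
      unfolding loclip_at_def using zero_less_one by blast
  qed
  from loclip_at_compose[OF loclip_at_Pair[OF f g] this] show ?thesis by simp
qed

lemma loclip_at_inverse:
  fixes f :: "_ \<Rightarrow> real"
  assumes f: "loclip_at f p" and nz: "f p \<noteq> 0"
  shows "loclip_at (\<lambda>x. inverse (f x)) p"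
proof -
  have D: "(inverse has_derivative (\<lambda>h::real. - (inverse x * h * inverse x))) (at x)"
    if "x \<noteq> 0" for x :: real
    using that by (auto intro!: derivative_eq_intros)
  then have D': "frechet_derivative inverse (at x) = (\<lambda>h::real. - (inverse x * h * inverse x))"
    if "x \<noteq> 0" for x :: real
    using that frechet_derivative_at by metis
  have "Ck_on (Suc 0) (- {0}) (inverse :: real \<Rightarrow> real)"
    unfolding Ck_on.simps
  proof (intro conjI ballI allI)
    show "inverse differentiable (at x)" if "x \<in> - {0}" for x :: real
      using D that by (auto simp: differentiable_def)
    show "continuous_on (- {0}) (\<lambda>x. frechet_derivative inverse (at x) v)" for v :: real
      by (subst continuous_on_cong[OF refl, where g = "\<lambda>x. - (inverse x * v * inverse x)"])
        (auto simp: D' intro!: continuous_intros)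
  qed
  then have "loclip_at inverse (f p)"
    by (rule loclip_at_C1[rotated 2]) (use nz in auto)
  then show ?thesis by (rule loclip_at_compose[OF f])
qed

section \<open>Lipschitz bounds for periodic functions\<close>

text \<open>Any two points are congruent modulo \<open>2\<pi>\<close> to a point of \<open>[0, 2\<pi>]\<close> and a point at distance at most
  \<open>\<pi>\<close> from it, and passing to these representatives does not increase the distance.\<close>

lemma periodic_lipschitz:
  fixes g :: "real \<Rightarrow> 'b::metric_space"
  assumes lip: "L-lipschitz_on {-pi..3*pi} g" and per: "\<And>x k::int. g (x + 2 * pi * of_int k) = g x"
  shows "L-lipschitz_on UNIV g"
proof (rule lipschitz_onI)
  fix x y :: real
  define k where "k = \<lfloor>x / (2 * pi)\<rfloor>"
  define x' where "x' = x - 2 * pi * of_int k"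
  have "of_int k \<le> x / (2 * pi)" "x / (2 * pi) < of_int k + 1"
    unfolding k_def by linarith+
  then have x': "0 \<le> x'" "x' \<le> 2 * pi"
    by (auto simp: x'_def field_simps)
  define j where "j = round ((y - x) / (2 * pi))"
  define d where "d = y - x - 2 * pi * of_int j"
  have "\<bar>(y - x) / (2 * pi) - of_int j\<bar> \<le> 1 / 2"
    unfolding j_def using of_int_round_abs_le[of "(y - x) / (2 * pi)"] by (simp add: abs_minus_commute)
  moreover have dd: "d = 2 * pi * ((y - x) / (2 * pi) - of_int j)"
  proof -
    have "2 * pi * ((y - x) / (2 * pi)) = y - x" by simp
    then show ?thesis unfolding d_def by (subst right_diff_distrib) simp
  qed
  ultimately have d: "\<bar>d\<bar> \<le> pi"
    using mult_left_mono[of "\<bar>(y - x) / (2 * pi) - of_int j\<bar>" "1/2" "2 * pi"]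
    by (simp add: abs_mult)
  have d2: "\<bar>d\<bar> \<le> \<bar>y - x\<bar>"
  proof (cases "\<bar>y - x\<bar> \<ge> pi")
    case True
    then show ?thesis using d by simp
  next
    case False
    then have "\<bar>(y - x) / (2 * pi)\<bar> < 1 / 2" by (simp add: abs_divide field_simps)
    then have "j = 0" unfolding j_def using round_unique'[of "(y - x) / (2 * pi)" 0] by simp
    then show ?thesis by (simp add: d_def)
  qed
  have "g x = g x'" using per[of x' k] by (simp add: x'_def)
  moreover have "g y = g (x' + d)"
    using per[of "x' + d" "j + k"] by (simp add: x'_def d_def algebra_simps)
  moreover have "dist (g x') (g (x' + d)) \<le> L * dist x' (x' + d)"
    by (rule lipschitz_onD[OF lip]) (use x' d in auto)
  moreover have "L * dist x' (x' + d) \<le> L * dist x y"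
    using d2 lipschitz_on_nonneg[OF lip]
    by (intro mult_left_mono) (auto simp: dist_real_def abs_minus_commute)
  ultimately show "dist (g x) (g y) \<le> L * dist x y" by simp
qed (rule lipschitz_on_nonneg[OF lip])

text \<open>Local Lipschitz bounds become uniform on the compact set \<open>{-R..R} \<times> {-\<pi>..3\<pi>}\<close>, and periodicity
  spreads them over the line.\<close>

lemma periodic_loclip_imp_lipschitz:
  fixes f :: "real \<Rightarrow> real \<Rightarrow> 'b::metric_space"
  assumes f: "\<And>t x. loclip_at (\<lambda>(t, x). f t x) (t, x)"
    and per: "\<And>t x k::int. f t (x + 2 * pi * of_int k) = f t x"
  shows "\<exists>L. \<forall>t. \<bar>t\<bar> \<le> R \<longrightarrow> L-lipschitz_on UNIV (f t)"
proof -
  have "local_lipschitz {-R..R} {-pi..3*pi} f"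
  proof (rule local_lipschitzI)
    fix t x
    obtain e L where e: "e > 0" "L-lipschitz_on (ball (t, x) e) (\<lambda>(t, x). f t x)"
      using f[of t x] by (auto simp: loclip_at_def)
    have "L-lipschitz_on (cball x (e/3) \<inter> {-pi..3*pi}) (f s)" if s: "s \<in> cball t (e/3) \<inter> {-R..R}" for s
    proof (rule lipschitz_onI)
      fix y z assume "y \<in> cball x (e/3) \<inter> {-pi..3*pi}" "z \<in> cball x (e/3) \<inter> {-pi..3*pi}"
      then have "(s, y) \<in> ball (t, x) e" "(s, z) \<in> ball (t, x) e"
        using s e(1) by (auto simp: dist_Pair_Pair
            intro!: le_less_trans[OF sqrt_sum_squares_le_sum])
      from lipschitz_onD[OF e(2) this] show "dist (f s y) (f s z) \<le> L * dist y z"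
        by (simp add: dist_Pair_Pair)
    qed (rule lipschitz_on_nonneg[OF e(2)])
    then show "\<exists>u>0. \<exists>L. \<forall>t\<in>cball t u \<inter> {-R..R}. L-lipschitz_on (cball x u \<inter> {-pi..3*pi}) (f t)"
      using e(1) by (intro exI[of _ "e/3"] conjI exI[of _ L]) auto
  qed
  moreover have "continuous_on {-R..R} (\<lambda>t. f t x)" for x
  proof (intro continuous_at_imp_continuous_on ballI)
    fix t
    have "isCont (\<lambda>(t, x). f t x) (t, x)" by (rule loclip_at_isCont[OF f])
    then show "isCont (\<lambda>t. f t x) t"
      using isCont_o2[where f = "\<lambda>t. (t, x)" and a = t and g = "\<lambda>(t, x). f t x"]
      by (simp add: continuous_Pair)
  qed
  ultimately obtain L where L: "\<And>t. t \<in> {-R..R} \<Longrightarrow> L-lipschitz_on {-pi..3*pi} (f t)"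
    using local_lipschitz_compact_implies_lipschitz[of "{-R..R}" "{-pi..3*pi}" f] by blast
  have "L-lipschitz_on UNIV (f t)" if "\<bar>t\<bar> \<le> R" for t
  proof (rule periodic_lipschitz)
    have "t \<in> {-R..R}" using that by auto
    then show "L-lipschitz_on {-pi..3*pi} (f t)" by (rule L)
  qed (rule per)
  then show ?thesis by blast
qed

section \<open>Smooth maps and their derivatives up to the boundary\<close>

lemma Ck_on_cong:
  assumes "Ck_on k V g" "open V" "\<And>x. x \<in> V \<Longrightarrow> f x = g x"
  shows "Ck_on k V f"
  using assms(1,3)
proof (induction k arbitrary: f g)
  case 0
  then show ?case by simp
next
  case (Suc k)
  have d: "(f has_derivative frechet_derivative g (at x)) (at x)" if x: "x \<in> V" for x
  proof (rule has_derivative_transform_within_open[OF _ assms(2) x])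
    show "(g has_derivative frechet_derivative g (at x)) (at x)"
      using Suc.prems(1) x by (simp add: frechet_derivative_works[symmetric])
  qed (use Suc.prems(2) in auto)
  have "Ck_on k V (\<lambda>x. frechet_derivative f (at x) v)" for v
  proof (rule Suc.IH)
    show "Ck_on k V (\<lambda>x. frechet_derivative g (at x) v)"
      using Suc.prems(1) by simp
  qed (simp add: frechet_derivative_at[OF d])
  then show ?case using d by (auto simp: differentiable_def)
qed

lemma Ck_on_local:
  assumes "\<And>x. x \<in> U \<Longrightarrow> \<exists>V. open V \<and> x \<in> V \<and> Ck_on k V f"
  shows "Ck_on k U f"
  using assms
proof (induction k arbitrary: f)
  case 0
  have "isCont f x" if "x \<in> U" for x
    using 0[OF that] by (auto simp: continuous_on_eq_continuous_at)
  then show ?case by (simp add: continuous_at_imp_continuous_on)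
next
  case (Suc k)
  have "f differentiable (at x)" if "x \<in> U" for x
    using Suc.prems[OF that] by auto
  moreover have "Ck_on k U (\<lambda>x. frechet_derivative f (at x) v)" for v
  proof (rule Suc.IH)
    fix x assume "x \<in> U"
    from Suc.prems[OF this] show "\<exists>V. open V \<and> x \<in> V \<and> Ck_on k V (\<lambda>x. frechet_derivative f (at x) v)"
      by auto
  qed
  ultimately show ?case by simp
qed

lemma smooth_on_UNIV_Ck:
  assumes "smooth_on UNIV f" shows "Ck_on k UNIV f"
proof (rule Ck_on_local)
  fix x
  obtain V g where "open V" "x \<in> V" "\<forall>k. Ck_on k V g" "\<forall>y\<in>UNIV \<inter> V. g y = f y"
    using assms unfolding smooth_on_def by (meson UNIV_I)
  then show "\<exists>V. open V \<and> x \<in> V \<and> Ck_on k V f"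
    using Ck_on_cong[of k V g f] by auto
qed

text \<open>At a boundary point of a convex body no full set of coordinate directions need stay inside,
  but the segments to all points of an inner ball do, and differences of their directions
  fill a neighbourhood of \<open>0\<close>.\<close>

lemma has_derivative_within_unique:
  fixes f :: "'a::real_normed_vector \<Rightarrow> 'b::real_normed_vector"
  assumes A: "(f has_derivative A) (at p within S)" and B: "(f has_derivative B) (at p within S)"
    and S: "convex S" "interior S \<noteq> {}" "p \<in> S"
  shows "A = B"
proof -
  interpret A: bounded_linear A using A by (rule has_derivative_bounded_linear)
  interpret B: bounded_linear B using B by (rule has_derivative_bounded_linear)
  have eq: "A (q - p) = B (q - p)" if q: "q \<in> S" for q
  proof -
    define l where "l t = p + t *\<^sub>R (q - p)" for t :: real
    have l: "l ` {0..1} \<subseteq> S"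
    proof -
      have "l t = (1 - t) *\<^sub>R p + t *\<^sub>R q" for t
        by (simp add: l_def algebra_simps)
      then show ?thesis
        using convexD[OF S(1,3) q] by auto
    qed
    have "(l has_derivative (\<lambda>t. t *\<^sub>R (q - p))) (at 0 within {0..1})"
      unfolding l_def by (auto intro!: derivative_eq_intros)
    note dl = has_derivative_in_compose[OF this]
    have "((\<lambda>t. f (l t)) has_vector_derivative C (q - p)) (at 0 within {0..1})"
      if C: "(f has_derivative C) (at p within S)" for C
    proof -
      have "(f has_derivative C) (at (l 0) within l ` {0..1})"
        using has_derivative_subset[OF C l] by (simp add: l_def)
      from dl[OF this] show ?thesis
        using linear_simps(5)[OF has_derivative_bounded_linear[OF C]]
        by (simp add: has_vector_derivative_def)
    qed
    from this[OF A] this[OF B] show ?thesis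
      by (rule vector_derivative_unique_within[rotated]) (simp add: trivial_limit_within islimpt_Icc)
  qed
  obtain q e where e: "e > 0" "ball q e \<subseteq> S"
    using S(2) by (auto simp: mem_interior)
  show "A = B"
  proof (rule ext)
    fix v :: 'a
    \<comment> \<open>\<open>s\<close> scales \<open>v\<close> so that \<open>q\<close> and \<open>q + s v\<close> both lie in the inner ball.\<close>
    define s where "s = e / (2 * (norm v + 1))"
    have s: "s > 0" using e(1) by (simp add: s_def add_nonneg_pos)
    have "norm (s *\<^sub>R v) < e"
    proof -
      have "norm (s *\<^sub>R v) = e * (norm v / (2 * (norm v + 1)))"
        using s e(1) by (simp add: s_def)
      also have "\<dots> < e * 1"
        using e(1) by (intro mult_strict_left_mono) (simp_all add: add_nonneg_pos)
      finally show ?thesis by simp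
    qed
    then have "q + s *\<^sub>R v \<in> S" "q \<in> S"
      using e by (auto simp: dist_norm intro!: subsetD[OF e(2)])
    from eq[OF this(1)] eq[OF this(2)]
    have "A ((q + s *\<^sub>R v - p) - (q - p)) = B ((q + s *\<^sub>R v - p) - (q - p))"
      by (simp only: A.diff[of "q + s *\<^sub>R v - p"] B.diff[of "q + s *\<^sub>R v - p"])
    then show "A v = B v" using s by (simp add: A.scaleR B.scaleR)
  qed
qed

text \<open>By uniqueness of the derivative within \<open>S\<close>, the derivatives of all local smooth extensions agree
  at the points of \<open>S\<close>; so regularity of the derivative up to the boundary can be read off any
  extension.\<close>

lemma smooth_on_extension_derivative:
  assumes "smooth_on S f" "convex S" "interior S \<noteq> {}" "p \<in> S"
  obtains U g where "open U" "p \<in> U" "\<And>k. Ck_on k U g" "\<And>y. y \<in> S \<inter> U \<Longrightarrow> g y = f y"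
    "\<And>q. q \<in> S \<inter> U \<Longrightarrow> frechet_derivative f (at q within S) = frechet_derivative g (at q)"
    "\<And>q. q \<in> S \<inter> U \<Longrightarrow> (f has_derivative frechet_derivative g (at q)) (at q within S)"
proof -
  obtain U g where g: "open U" "p \<in> U" "\<forall>k. Ck_on k U g" "\<forall>y\<in>S \<inter> U. g y = f y"
    using assms(1,4) unfolding smooth_on_def by blast
  have d: "(f has_derivative frechet_derivative g (at q)) (at q within S)" if q: "q \<in> S \<inter> U" for q
  proof -
    have "Ck_on (Suc 0) U g" using g(3) by blast
    then have "(g has_derivative frechet_derivative g (at q)) (at q)"
      using q by (simp add: frechet_derivative_works[symmetric])
    then have "(g has_derivative frechet_derivative g (at q)) (at q within S)"
      by (rule has_derivative_at_withinI)
    moreover have "\<forall>\<^sub>F y in at q within S. g y = f y"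
      using g(1,4) q by (auto simp: eventually_at_topological)
    ultimately show ?thesis
      using has_derivative_transform_eventually g(4) q by blast
  qed
  have "frechet_derivative f (at q within S) = frechet_derivative g (at q)" if q: "q \<in> S \<inter> U" for q
    using d[OF q] has_derivative_within_unique[OF _ d[OF q] assms(2,3)] q
    by (meson IntD1 differentiableI frechet_derivative_works)
  with d g show thesis by (intro that[of U g]) blast+
qed

lemma smooth_on_has_derivative:
  assumes "smooth_on S f" "convex S" "interior S \<noteq> {}" "p \<in> S"
  shows "(f has_derivative frechet_derivative f (at p within S)) (at p within S)"
  using smooth_on_extension_derivative[OF assms] assms(4) by (metis IntI)

lemma smooth_on_continuous_derivative:
  assumes "smooth_on S f" "convex S" "interior S \<noteq> {}"
  shows "continuous_on S (\<lambda>p. frechet_derivative f (at p within S) v)"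
  unfolding continuous_on_eq_continuous_within
proof
  fix p assume p: "p \<in> S"
  obtain U g where U: "open U" "p \<in> U" and g: "\<And>k. Ck_on k U g"
    "\<And>q. q \<in> S \<inter> U \<Longrightarrow> frechet_derivative f (at q within S) = frechet_derivative g (at q)"
    by (rule smooth_on_extension_derivative[OF assms p]) blast
  have "continuous_on U (\<lambda>q. frechet_derivative g (at q) v)"
    using g(1)[of "Suc 0"] by simp
  then have "continuous (at p within S) (\<lambda>q. frechet_derivative g (at q) v)"
    using U continuous_on_eq_continuous_at continuous_at_imp_continuous_at_within by blast
  moreover have "\<forall>\<^sub>F q in at p within S. frechet_derivative g (at q) v = frechet_derivative f (at q within S) v"
    using U g(2) by (auto simp: eventually_at_topological)
  ultimately show "continuous (at p within S) (\<lambda>q. frechet_derivative f (at q within S) v)"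
    using g(2)[of p] p U(2) unfolding continuous_within
    by (auto intro: Lim_transform_eventually)
qed

lemma linear_Basis_sum:
  fixes A :: "'a::euclidean_space \<Rightarrow> 'b::real_vector"
  assumes "linear A" shows "A v = (\<Sum>b\<in>Basis. (v \<bullet> b) *\<^sub>R A b)"
  using linear_sum[OF assms, of "\<lambda>b. (v \<bullet> b) *\<^sub>R b" Basis]
  by (simp add: euclidean_representation linear_scale[OF assms])

lemma smooth_on_derivative_linear:
  assumes "smooth_on S f" "convex S" "interior S \<noteq> {}" "p \<in> S"
  shows "linear (frechet_derivative f (at p within S))"
  using smooth_on_has_derivative[OF assms] by (rule has_derivative_linear)

lemma smooth_on_continuous_derivative_compose:
  fixes f :: "'a::euclidean_space \<Rightarrow> 'b::real_normed_vector"
  assumes f: "smooth_on S f" "convex S" "interior S \<noteq> {}"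
    and m: "continuous_on X m" "m ` X \<subseteq> S" and w: "continuous_on X w"
  shows "continuous_on X (\<lambda>x. frechet_derivative f (at (m x) within S) (w x))"
proof -
  have "continuous_on X (\<lambda>x. \<Sum>b\<in>Basis. (w x \<bullet> b) *\<^sub>R frechet_derivative f (at (m x) within S) b)"
    using continuous_on_compose2[OF smooth_on_continuous_derivative[OF f] m]
    by (intro continuous_intros w)
  then show ?thesis
    by (rule continuous_on_eq)
      (use m(2) in \<open>auto simp: linear_Basis_sum[OF smooth_on_derivative_linear[OF f], symmetric]\<close>)
qed

lemma smooth_on_loclip_compose:
  fixes f :: "'a::euclidean_space \<Rightarrow> 'b::real_normed_vector"
  assumes f: "smooth_on S f" "convex S" "interior S \<noteq> {}"
    and m: "loclip_at m x" "range m \<subseteq> S"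
  shows "loclip_at (\<lambda>x. f (m x)) x"
    and "loclip_at w x \<Longrightarrow> loclip_at (\<lambda>x. frechet_derivative f (at (m x) within S) (w x)) x"
proof -
  have mx: "m y \<in> S" for y using m(2) by blast
  obtain U g where U: "open U" "m x \<in> U" and g: "\<And>k. Ck_on k U g" "\<And>y. y \<in> S \<inter> U \<Longrightarrow> g y = f y"
    "\<And>q. q \<in> S \<inter> U \<Longrightarrow> frechet_derivative f (at q within S) = frechet_derivative g (at q)"
    by (rule smooth_on_extension_derivative[OF f mx]) blast
  obtain V where V: "open V" "x \<in> V" "\<And>y. y \<in> V \<Longrightarrow> m y \<in> U"
    using loclip_at_isCont[OF m(1)] U unfolding continuous_at_open by metis
  have "loclip_at (\<lambda>x. g (m x)) x"
    by (rule loclip_at_compose[OF m(1)]) (rule loclip_at_C1[OF U g(1)])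
  then show "loclip_at (\<lambda>x. f (m x)) x"
    by (rule loclip_at_cong[OF _ V(1,2)]) (use V(3) g(2) mx in auto)
  assume w: "loclip_at w x"
  have "Ck_on (Suc 0) U (\<lambda>q. frechet_derivative g (at q) b)" for b
    using g(1)[of "Suc (Suc 0)"] unfolding Ck_on.simps(2)[of "Suc 0"] by blast
  then have "loclip_at (\<lambda>x. frechet_derivative g (at (m x)) b) x" for b
    by (intro loclip_at_compose[OF m(1)] loclip_at_C1[OF U])
  then have "loclip_at (\<lambda>x. \<Sum>b\<in>Basis. (w x \<bullet> b) *\<^sub>R frechet_derivative g (at (m x)) b) x"
    by (intro loclip_at_sum loclip_at_scaleR finite_Basis
        loclip_at_bounded_linear_compose[OF bounded_linear_inner_left w])
  then show "loclip_at (\<lambda>x. frechet_derivative f (at (m x) within S) (w x)) x"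
  proof (rule loclip_at_cong[OF _ V(1,2)])
    fix y assume "y \<in> V"
    then have "frechet_derivative f (at (m y) within S) = frechet_derivative g (at (m y))"
      using V(3) g(3) mx by blast
    then show "frechet_derivative f (at (m y) within S) (w y)
        = (\<Sum>b\<in>Basis. (w y \<bullet> b) *\<^sub>R frechet_derivative g (at (m y)) b)"
      using linear_Basis_sum[OF smooth_on_derivative_linear[OF f mx[of y]], of "w y"] by simp
  qed
qed

text \<open>A curve in \<open>S\<close> may touch the boundary of \<open>S\<close> or run along it, where \<open>f\<close> is differentiable only
  within \<open>S\<close>; the derivative within \<open>S\<close> restricts to the image of the curve, which is all that the
  chain rule sees.\<close>

lemma smooth_on_compose_curve:
  assumes f: "smooth_on S f" "convex S" "interior S \<noteq> {}"
    and m: "(m has_vector_derivative m') (at s within I)" "m ` I \<subseteq> S" "s \<in> I"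
  shows "((\<lambda>s. f (m s)) has_vector_derivative frechet_derivative f (at (m s) within S) m') (at s within I)"
proof -
  have ms: "m s \<in> S" using m(2,3) by blast
  have "(f has_derivative frechet_derivative f (at (m s) within S)) (at (m s) within m ` I)"
    using has_derivative_subset[OF smooth_on_has_derivative[OF f ms] m(2)] .
  from has_derivative_in_compose[OF m(1)[unfolded has_vector_derivative_def] this]
  show ?thesis
    by (simp add: has_vector_derivative_def linear_scale[OF smooth_on_derivative_linear[OF f ms]])
qed

section \<open>Second derivatives and the Levi form\<close>

lemma smooth_on_UNIV_iff: "smooth_on UNIV f \<longleftrightarrow> (\<forall>k. Ck_on k UNIV f)"
proof
  show "\<forall>k. Ck_on k UNIV f" if "smooth_on UNIV f"
    using smooth_on_UNIV_Ck[OF that] by blast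
  show "smooth_on UNIV f" if "\<forall>k. Ck_on k UNIV f"
    unfolding smooth_on_def using that by (intro ballI exI[of _ UNIV] exI[of _ f]) auto
qed

lemma smooth_derivative:
  assumes "smooth_on UNIV f"
  shows "smooth_on UNIV (\<lambda>x. frechet_derivative f (at x) v)"
proof -
  have "Ck_on (Suc k) UNIV f" for k using assms unfolding smooth_on_UNIV_iff by blast
  then show ?thesis unfolding smooth_on_UNIV_iff by simp
qed

definition hess :: "('a::real_normed_vector \<Rightarrow> real) \<Rightarrow> 'a \<Rightarrow> 'a \<Rightarrow> 'a \<Rightarrow> real" where
  "hess H p v w = frechet_derivative (\<lambda>x. frechet_derivative H (at x) w) (at p) v"

context
  fixes H :: "'a::euclidean_space \<Rightarrow> real"
  assumes H: "smooth_on UNIV H"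
begin

lemma smooth_has_derivative: "(H has_derivative frechet_derivative H (at p)) (at p)"
  using smooth_on_has_derivative[OF H] by simp

lemma smooth_derivative_linear: "linear (frechet_derivative H (at p))"
  using smooth_on_derivative_linear[OF H] by simp

lemma has_derivative_derivative:
  "((\<lambda>x. frechet_derivative H (at x) w) has_derivative (\<lambda>v. hess H p v w)) (at p)"
  unfolding hess_def using smooth_on_has_derivative[OF smooth_derivative[OF H]] by simp

lemma hess_linear_right: "linear (hess H p v)"
proof -
  have "((\<lambda>x. \<Sum>b\<in>Basis. (w \<bullet> b) *\<^sub>R frechet_derivative H (at x) b) has_derivative
      (\<lambda>v. \<Sum>b\<in>Basis. (w \<bullet> b) *\<^sub>R hess H p v b)) (at p)" for w
    by (intro has_derivative_sum has_derivative_scaleR_right has_derivative_derivative)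
  moreover have "(\<lambda>x. \<Sum>b\<in>Basis. (w \<bullet> b) *\<^sub>R frechet_derivative H (at x) b)
      = (\<lambda>x. frechet_derivative H (at x) w)" for w
    by (rule ext) (rule linear_Basis_sum[OF smooth_derivative_linear, symmetric])
  ultimately have "((\<lambda>x. frechet_derivative H (at x) w) has_derivative
      (\<lambda>v. \<Sum>b\<in>Basis. (w \<bullet> b) *\<^sub>R hess H p v b)) (at p)" for w
    by simp
  from has_derivative_unique[OF has_derivative_derivative this]
  have "hess H p v w = (\<Sum>b\<in>Basis. (w \<bullet> b) *\<^sub>R hess H p v b)" for w
    by (rule fun_cong)
  then have "hess H p v = (\<lambda>w. \<Sum>b\<in>Basis. (w \<bullet> b) *\<^sub>R hess H p v b)"
    by blast
  moreover have "linear (\<lambda>w. \<Sum>b\<in>Basis. (w \<bullet> b) *\<^sub>R hess H p v b)"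
    by (intro linearI) (simp_all add: inner_add_left distrib_right sum.distrib sum_distrib_left
        mult.assoc)
  ultimately show ?thesis by simp
qed

lemma continuous_on_hess:
  assumes "continuous_on X p" "continuous_on X v" "continuous_on X w"
  shows "continuous_on X (\<lambda>x. hess H (p x) (v x) (w x))"
proof -
  have "continuous_on X (\<lambda>x. hess H (p x) (v x) b)" for b
    unfolding hess_def
    using smooth_on_continuous_derivative_compose[OF smooth_derivative[OF H] _ _ assms(1) _ assms(2)]
    by simp
  then have "continuous_on X (\<lambda>x. \<Sum>b\<in>Basis. (w x \<bullet> b) *\<^sub>R hess H (p x) (v x) b)"
    by (intro continuous_intros assms)
  then show ?thesis by (subst linear_Basis_sum[OF hess_linear_right])
qed

text \<open>The product rule for a pairing, after expanding \<open>w\<close> in a basis. It is used with \<open>w\<close> the velocity of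
  the curve, where it computes the second derivative of \<open>H\<close> along the curve.\<close>

lemma derivative_along_curve_has_derivative:
  assumes p: "(p has_vector_derivative p') (at s)" and w: "(w has_vector_derivative w') (at s)"
  shows "((\<lambda>s. frechet_derivative H (at (p s)) (w s)) has_real_derivative
      hess H (p s) p' (w s) + frechet_derivative H (at (p s)) w') (at s)"
proof -
  let ?d = "\<lambda>x b. frechet_derivative H (at x) b"
  have 1: "((\<lambda>s. ?d (p s) b) has_real_derivative hess H (p s) p' b) (at s)" for b
    using smooth_on_compose_curve[OF smooth_derivative[OF H] _ _ p]
    by (simp add: has_real_derivative_iff_has_vector_derivative hess_def)
  have 2: "((\<lambda>s. w s \<bullet> b) has_real_derivative w' \<bullet> b) (at s)" for b
    unfolding has_real_derivative_iff_has_vector_derivative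
    by (rule bounded_linear.has_vector_derivative[OF bounded_linear_inner_left w])
  have "((\<lambda>s. \<Sum>b\<in>Basis. (w s \<bullet> b) * ?d (p s) b) has_real_derivative
      (\<Sum>b\<in>Basis. (w s \<bullet> b) * hess H (p s) p' b + (w' \<bullet> b) * ?d (p s) b)) (at s)"
    by (rule DERIV_sum) (rule DERIV_cong[OF DERIV_mult[OF 2 1]], simp add: mult.commute)
  moreover have "(\<Sum>b\<in>Basis. (v \<bullet> b) * ?d x b) = ?d x v" for x v
    using linear_Basis_sum[OF smooth_derivative_linear, of x v] by simp
  moreover have "(\<Sum>b\<in>Basis. (w s \<bullet> b) * hess H (p s) p' b) = hess H (p s) p' (w s)"
    using linear_Basis_sum[OF hess_linear_right, of "p s" p' "w s"] by simp
  ultimately show ?thesis by (simp only: sum.distrib)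
qed

end


text \<open>In terms of second derivatives, \<open>-d(dH \<circ> \<i>)(v, \<i>v)\<close> is \<open>D\<^sup>2H(v, v) + D\<^sup>2H(\<i>v, \<i>v)\<close>.\<close>

lemma levi_form_pos:
  assumes H: "smooth_on UNIV H" and psh: "strictly_psh H" and v: "v \<noteq> 0"
  shows "0 < hess H p v v + hess H p (\<i> *s v) (\<i> *s v)"
proof -
  have ii: "\<i> *s (\<i> *s v) = - v" by (simp add: vec_eq_iff)
  have "hess H p v (- v) = - hess H p v v"
    using linear_neg[OF hess_linear_right[OF H]] by blast
  moreover have "- ext_deriv (\<lambda>x u. frechet_derivative H (at x) (\<i> *s u)) p v (\<i> *s v)
      = - hess H p v (- v) + hess H p (\<i> *s v) (\<i> *s v)"
    by (simp add: ext_deriv_def hess_def ii)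
  ultimately show ?thesis
    using psh v unfolding strictly_psh_def by (metis add.inverse_inverse)
qed

section \<open>Tangent spaces of images and regular level sets\<close>

lemma C1_on_vector_derivativeI:
  assumes "\<And>s. s \<in> S \<Longrightarrow> (f has_vector_derivative D s) (at s)" "continuous_on S D"
  shows "f C1_differentiable_on S"
  using assms unfolding C1_differentiable_on_def by blast

lemma tangent_space_mono: "S \<subseteq> S' \<Longrightarrow> tangent_space S p \<subseteq> tangent_space S' p"
  unfolding tangent_space_def by blast

lemma tangent_space_image:
  fixes f :: "'a::euclidean_space \<Rightarrow> 'b::real_normed_vector"
  assumes f: "smooth_on S f" "convex S" "interior S \<noteq> {}" and sub: "N \<subseteq> S"
    and w: "w \<in> tangent_space N p"
  shows "frechet_derivative f (at p within S) w \<in> tangent_space (f ` N) (f p)"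
proof -
  obtain \<gamma> e where e: "e > 0" and C1: "\<gamma> C1_differentiable_on {-e<..<e}"
    and N: "\<gamma> ` {-e<..<e} \<subseteq> N" and \<gamma>0: "\<gamma> 0 = p" and d0: "(\<gamma> has_vector_derivative w) (at 0)"
    using w unfolding tangent_space_def by blast
  obtain D where D: "\<And>s. s \<in> {-e<..<e} \<Longrightarrow> (\<gamma> has_vector_derivative D s) (at s)"
    and contD: "continuous_on {-e<..<e} D"
    using C1 unfolding C1_differentiable_on_def by blast
  have d: "((\<lambda>s. f (\<gamma> s)) has_vector_derivative frechet_derivative f (at (\<gamma> s) within S) (D s)) (at s)"
    if s: "s \<in> {-e<..<e}" for s
    using smooth_on_compose_curve[OF f has_vector_derivative_at_within[OF D[OF s]] _ s] N sub s
    by (simp add: at_within_open[OF s open_greaterThanLessThan] order_trans[OF N sub])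
  have "D 0 = w"
    using e by (intro vector_derivative_unique_at[OF D d0]) simp
  then have "((\<lambda>s. f (\<gamma> s)) has_vector_derivative frechet_derivative f (at p within S) w) (at 0)"
    using d[of 0] e \<gamma>0 by simp
  moreover have "(\<lambda>s. f (\<gamma> s)) C1_differentiable_on {-e<..<e}"
  proof (rule C1_on_vector_derivativeI[OF d])
    show "continuous_on {-e<..<e} (\<lambda>s. frechet_derivative f (at (\<gamma> s) within S) (D s))"
    proof (rule smooth_on_continuous_derivative_compose[OF f _ _ contD])
      show "continuous_on {-e<..<e} \<gamma>"
        by (intro continuous_at_imp_continuous_on ballI has_vector_derivative_continuous[OF D])
      show "\<gamma> ` {-e<..<e} \<subseteq> S" using N sub by (rule order_trans)
    qed
  qed
  moreover have "(\<lambda>s. f (\<gamma> s)) ` {-e<..<e} \<subseteq> f ` N" using N by blast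
  ultimately show ?thesis
    unfolding tangent_space_def using e \<gamma>0
    by (intro CollectI exI[of _ "\<lambda>s. f (\<gamma> s)"] exI[of _ e]) simp
qed

text \<open>Implicit function theorem. In the affine plane through \<open>q\<close> spanned by \<open>v\<close> and the transverse
  direction \<open>n\<close>, the map \<open>(s, y) \<mapsto> (s, H (q + s v + y n))\<close> has invertible derivative at the origin;
  its local inverse over the line of second coordinate \<open>c\<close> is a curve in the level set. Its
  velocity at \<open>q\<close> is \<open>v\<close> because the correction in direction \<open>n\<close> starts with velocity \<open>0\<close>.\<close>

lemma kernel_subset_tangent_level_set:
  fixes H :: "'a::euclidean_space \<Rightarrow> real"
  assumes H: "smooth_on UNIV H" and q: "H q = c" and n: "frechet_derivative H (at q) n \<noteq> 0"
    and v: "frechet_derivative H (at q) v = 0"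
  shows "v \<in> tangent_space (H -` {c}) q"
proof -
  let ?d = "\<lambda>p. frechet_derivative H (at p)"
  define \<kappa> where "\<kappa> = ?d q n"
  define P where "P x = q + fst x *\<^sub>R v + snd x *\<^sub>R n" for x :: "real \<times> real"
  define f where "f x = (fst x, H (P x))" for x
  define A B C :: "(real \<times> real) \<Rightarrow>\<^sub>L (real \<times> real)"
    where "A = Blinfun (\<lambda>x. (fst x, 0))" and "B = Blinfun (\<lambda>x. (0, fst x))"
      and "C = Blinfun (\<lambda>x. (0, snd x))"
  have ABC: "blinfun_apply A x = (fst x, 0)" "blinfun_apply B x = (0, fst x)"
    "blinfun_apply C x = (0, snd x)" for x
    unfolding A_def B_def C_def
    by (auto intro!: bounded_linear_Blinfun_apply[THEN fun_cong] bounded_linear_intros)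
  define f' where "f' x = A + ?d (P x) v *\<^sub>R B + ?d (P x) n *\<^sub>R C" for x
  have f': "blinfun_apply (f' x) y = (fst y, ?d (P x) v * fst y + ?d (P x) n * snd y)" for x y
    by (simp add: f'_def ABC blinfun.bilinear_simps)
  have contP: "continuous_on X P" for X
    unfolding P_def by (intro continuous_intros)
  have contd: "continuous_on X (\<lambda>x. ?d (p x) w)" if "continuous_on X p"
    for X w and p :: "'c::topological_space \<Rightarrow> 'a"
    using smooth_on_continuous_derivative_compose[OF H _ _ that _ continuous_on_const] by simp
  have df: "(f has_derivative blinfun_apply (f' x)) (at x)" for x
  proof -
    have "(P has_derivative (\<lambda>y. fst y *\<^sub>R v + snd y *\<^sub>R n)) (at x)"
      unfolding P_def by (auto intro!: derivative_eq_intros)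
    from has_derivative_compose[OF this smooth_has_derivative[OF H]]
    have "((\<lambda>x. H (P x)) has_derivative (\<lambda>y. ?d (P x) v * fst y + ?d (P x) n * snd y)) (at x)"
      using smooth_derivative_linear[OF H, of "P x"]
      by (simp add: linear_add linear_scale mult.commute)
    then show ?thesis
      unfolding f_def f'[abs_def] by (auto intro!: derivative_eq_intros)
  qed
  have "(A + (1 / \<kappa>) *\<^sub>R C) o\<^sub>L f' (0, 0) = id_blinfun"
    by (rule blinfun_eqI) (use n v in \<open>simp add: f' ABC blinfun.bilinear_simps P_def \<kappa>_def\<close>)
  moreover have "continuous_on UNIV f'"
    unfolding f'_def by (intro continuous_intros contd contP)
  ultimately obtain U V g g' where V: "open V" "f (0, 0) \<in> V" and hom: "homeomorphism U V f g"
    and U: "(0, 0) \<in> U"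
    and g: "\<And>y. y \<in> V \<Longrightarrow> (g has_derivative (g' y)) (at y)"
    using inverse_function_theorem[of UNIV f f' "(0, 0)"] df open_UNIV UNIV_I by metis
  define \<sigma> where "\<sigma> s = snd (g (s, c))" for s
  define \<gamma> where "\<gamma> s = q + s *\<^sub>R v + \<sigma> s *\<^sub>R n" for s
  have f0: "f (0, 0) = (0, c)" by (simp add: f_def P_def q)
  then have g0: "g (0, c) = (0, 0)" using homeomorphism_apply1[OF hom U] by simp
  have \<gamma>H: "H (\<gamma> s) = c" if s: "(s, c) \<in> V" for s
  proof -
    have "f (g (s, c)) = (s, c)" using homeomorphism_apply2[OF hom s] .
    then show ?thesis by (auto simp: f_def P_def \<gamma>_def \<sigma>_def)
  qed
  obtain e where e: "e > 0" "\<And>s. \<bar>s\<bar> < e \<Longrightarrow> (s, c) \<in> V"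
  proof -
    have "open ((\<lambda>s. (s, c)) -` V)"
      by (intro open_vimage V continuous_intros)
    moreover have "0 \<in> (\<lambda>s. (s, c)) -` V" using V(2) f0 by simp
    ultimately obtain r where r: "r > 0" "ball 0 r \<subseteq> (\<lambda>s. (s, c)) -` V"
      by (rule openE)
    have "(s, c) \<in> V" if "\<bar>s\<bar> < r" for s
      using subsetD[OF r(2), of s] that by (simp add: dist_real_def)
    then show thesis by (rule that[OF r(1)])
  qed
  have d\<sigma>: "\<exists>\<sigma>'. (\<sigma> has_vector_derivative \<sigma>') (at s)" if "\<bar>s\<bar> < e" for s
  proof -
    have "((\<lambda>s. (s, c)) has_derivative (\<lambda>h. (h, 0))) (at s)"
      by (auto intro!: derivative_eq_intros)
    from has_derivative_compose[OF this g[OF e(2)[OF that]]]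
    have "(\<sigma> has_derivative (\<lambda>h. snd (g' (s, c) (h, 0)))) (at s)"
      unfolding \<sigma>_def by (rule has_derivative_snd)
    then show ?thesis
      using differentiableI vector_derivative_works by blast
  qed
  then obtain \<sigma>' where \<sigma>': "\<And>s. \<bar>s\<bar> < e \<Longrightarrow> (\<sigma> has_vector_derivative \<sigma>' s) (at s)"
    by metis
  have d\<gamma>: "(\<gamma> has_vector_derivative v + \<sigma>' s *\<^sub>R n) (at s)" if "\<bar>s\<bar> < e" for s
    unfolding \<gamma>_def using \<sigma>'[OF that]
    by (auto intro!: derivative_eq_intros simp: has_real_derivative_iff_has_vector_derivative)
  have cont\<gamma>: "continuous_on {-e<..<e} \<gamma>"
    by (intro continuous_at_imp_continuous_on ballI has_vector_derivative_continuous[OF d\<gamma>]) auto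
  have tangent: "?d (\<gamma> s) v + \<sigma>' s * ?d (\<gamma> s) n = 0" if s: "\<bar>s\<bar> < e" for s
  proof -
    have "((\<lambda>s. H (\<gamma> s)) has_vector_derivative ?d (\<gamma> s) (v + \<sigma>' s *\<^sub>R n)) (at s)"
      using smooth_on_compose_curve[OF H _ _ d\<gamma>[OF s]] by simp
    moreover have "((\<lambda>s. H (\<gamma> s)) has_vector_derivative 0) (at s)"
    proof (rule has_vector_derivative_transform_within_open[where S = "{-e<..<e}"])
      show "((\<lambda>s. c) has_vector_derivative 0) (at s)" by simp
    qed (use s \<gamma>H e in auto)
    ultimately have "?d (\<gamma> s) (v + \<sigma>' s *\<^sub>R n) = 0"
      by (rule vector_derivative_unique_at)
    then show ?thesis
      using smooth_derivative_linear[OF H, of "\<gamma> s"] by (simp add: linear_add linear_scale)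
  qed
  have \<gamma>0: "\<gamma> 0 = q" by (simp add: \<gamma>_def \<sigma>_def g0)
  obtain r where r: "0 < r" "r \<le> e" "\<And>s. \<bar>s\<bar> < r \<Longrightarrow> ?d (\<gamma> s) n \<noteq> 0"
  proof -
    have "isCont (\<lambda>s. ?d (\<gamma> s) n) 0"
      using contd[OF cont\<gamma>] e(1) by (simp add: continuous_on_eq_continuous_at)
    from continuous_at_avoid[OF this, of 0] n \<gamma>0
    obtain d where "d > 0" "\<And>s. dist 0 s < d \<Longrightarrow> ?d (\<gamma> s) n \<noteq> 0" by auto
    then show thesis using e(1) by (intro that[of "min d e"]) auto
  qed
  \<comment> \<open>Solving \<open>tangent\<close> for \<open>\<sigma>'\<close> shows that \<open>\<sigma>'\<close> is continuous, so that the curve is \<open>C\<^sup>1\<close>.\<close>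
  have \<sigma>'_eq: "\<sigma>' s = - ?d (\<gamma> s) v / ?d (\<gamma> s) n" if "\<bar>s\<bar> < r" for s
    using tangent[of s] r(2) r(3)[OF that] that by (auto simp: field_simps)
  have "\<gamma> C1_differentiable_on {-r<..<r}"
  proof (rule C1_on_vector_derivativeI)
    show "(\<gamma> has_vector_derivative v + (- ?d (\<gamma> s) v / ?d (\<gamma> s) n) *\<^sub>R n) (at s)"
      if "s \<in> {-r<..<r}" for s
      using d\<gamma>[of s] \<sigma>'_eq[of s] r(2) that by auto
    have "continuous_on {-r<..<r} \<gamma>"
      using cont\<gamma> by (rule continuous_on_subset) (use r(2) in auto)
    then show "continuous_on {-r<..<r} (\<lambda>s. v + (- ?d (\<gamma> s) v / ?d (\<gamma> s) n) *\<^sub>R n)"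
      by (intro continuous_intros contd ballI r(3)) auto
  qed
  moreover have "(\<gamma> has_vector_derivative v) (at 0)"
    using d\<gamma>[of 0] \<sigma>'_eq[of 0] r(1,2) \<gamma>0 v by simp
  moreover have "\<gamma> ` {-r<..<r} \<subseteq> H -` {c}"
    using \<gamma>H e(2) r(2) by auto
  ultimately show ?thesis
    unfolding tangent_space_def using r(1) \<gamma>0 by blast
qed

section \<open>Boundary derivatives of strictly subharmonic functions\<close>

lemma second_derivative_at_max_nonpos:
  fixes g :: "real \<Rightarrow> real"
  assumes e: "0 < e" and g: "\<And>s. \<bar>s\<bar> < e \<Longrightarrow> (g has_real_derivative g' s) (at s)"
    and g': "(g' has_real_derivative g'') (at 0)"
    and max: "\<And>s. \<bar>s\<bar> < e \<Longrightarrow> g s \<le> g 0"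
  shows "g'' \<le> 0"
proof (rule ccontr)
  assume "\<not> g'' \<le> 0"
  have "g' 0 = 0"
    by (rule DERIV_local_max[OF g e]) (use e max in auto)
  obtain d where d: "d > 0" "\<And>h. 0 < h \<Longrightarrow> h < d \<Longrightarrow> g' 0 < g' h"
    using DERIV_pos_inc_right[OF g'] \<open>\<not> g'' \<le> 0\<close> by auto
  define h where "h = min d e / 2"
  have h: "0 < h" "h < d" "h < e" using d(1) e by (auto simp: h_def min_def)
  obtain z where z: "0 < z" "z < h" "g h - g 0 = (h - 0) * g' z"
    using MVT2[of 0 h g g'] h g by auto
  have "0 < g' z" using d(2)[of z] z h \<open>g' 0 = 0\<close> by simp
  then have "0 < (h - 0) * g' z" using h(1) by simp
  then show False using z(3) max[of h] h by simp
qed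

text \<open>The function \<open>\<phi> - \<delta>/4 \<cdot> \<bar>z\<bar>\<^sup>2\<close> still has positive Laplacian, since the Laplacian of \<open>\<bar>z\<bar>\<^sup>2\<close> is \<open>4\<close>.
  So it has no interior maximum: there the second derivatives in the directions \<open>1\<close> and \<open>\<i>\<close>,
  whose sum is the Laplacian, would both be nonpositive. Here \<open>P d\<close> and \<open>Q d\<close> stand for the first
  and second derivative of \<open>\<phi>\<close> in direction \<open>d\<close>.\<close>

lemma strict_laplacian_max_principle:
  fixes \<phi> :: "complex \<Rightarrow> real"
  assumes cont: "continuous_on (cball 0 1) \<phi>" and bd: "\<And>z. z \<in> sphere 0 1 \<Longrightarrow> \<phi> z = c"
    and D1: "\<And>d z s. d \<in> {1, \<i>} \<Longrightarrow> z + of_real s * d \<in> ball 0 1 \<Longrightarrow>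
      ((\<lambda>s. \<phi> (z + of_real s * d)) has_real_derivative P d (z + of_real s * d)) (at s)"
    and D2: "\<And>d z. d \<in> {1, \<i>} \<Longrightarrow> z \<in> ball 0 1 \<Longrightarrow>
      ((\<lambda>s. P d (z + of_real s * d)) has_real_derivative Q d z) (at 0)"
    and lap: "\<And>z. z \<in> ball 0 1 \<Longrightarrow> \<delta> < Q 1 z + Q \<i> z"
    and z: "z \<in> cball 0 1"
  shows "\<phi> z \<le> c - \<delta> / 4 * (1 - (cmod z)\<^sup>2)"
proof -
  define \<psi> where "\<psi> z = \<phi> z - \<delta> / 4 * (cmod z)\<^sup>2" for z
  have "continuous_on (cball 0 1) \<psi>"
    unfolding \<psi>_def by (intro continuous_intros cont)
  then obtain m where m: "m \<in> cball 0 1" and max: "\<And>z. z \<in> cball 0 1 \<Longrightarrow> \<psi> z \<le> \<psi> m"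
    using continuous_attains_sup[of "cball (0::complex) 1" \<psi>] compact_cball by auto
  have "m \<notin> ball 0 1"
  proof
    assume m: "m \<in> ball 0 1"
    then obtain e where e: "e > 0" "ball m e \<subseteq> ball 0 1"
      using open_ball openE by blast
    have "Q d m - \<delta> / 2 \<le> 0" if d: "d \<in> {1, \<i>}" for d
    proof (rule second_derivative_at_max_nonpos[OF e(1),
          where g = "\<lambda>s. \<psi> (m + of_real s * d)" and
            g' = "\<lambda>s. P d (m + of_real s * d) - \<delta> / 4 * (2 * (m \<bullet> d) + 2 * s)"])
      have nd: "cmod d = 1" using d by auto
      have in_ball: "m + of_real s * d \<in> ball 0 1" if "\<bar>s\<bar> < e" for s
        using that by (intro subsetD[OF e(2)]) (simp add: dist_norm norm_mult nd)
      have sq: "(cmod (m + of_real s * d))\<^sup>2 = (cmod m)\<^sup>2 + 2 * s * (m \<bullet> d) + s\<^sup>2" for s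
      proof -
        have "of_real s * d = s *\<^sub>R d" by (simp add: scaleR_conv_of_real)
        then show ?thesis
          using nd unfolding power2_norm_eq_inner
          by (simp add: inner_add_left inner_add_right inner_commute
              norm_eq_1 power2_eq_square algebra_simps)
      qed
      fix s :: real assume s: "\<bar>s\<bar> < e"
      show "((\<lambda>s. \<psi> (m + of_real s * d)) has_real_derivative
          P d (m + of_real s * d) - \<delta> / 4 * (2 * (m \<bullet> d) + 2 * s)) (at s)"
        unfolding \<psi>_def sq
        by (rule DERIV_diff[OF D1[OF d in_ball[OF s]]]) (auto intro!: derivative_eq_intros)
      show "\<psi> (m + of_real s * d) \<le> \<psi> (m + of_real 0 * d)"
        using max[of "m + of_real s * d"] in_ball[OF s] by simp
    next
      show "((\<lambda>s. P d (m + of_real s * d) - \<delta> / 4 * (2 * (m \<bullet> d) + 2 * s))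
          has_real_derivative Q d m - \<delta> / 2) (at 0)"
        by (rule DERIV_diff[OF D2[OF d m]]) (auto intro!: derivative_eq_intros)
    qed
    from this[of 1] this[of \<i>] lap[OF m] show False by simp
  qed
  then have nm: "cmod m = 1" using m by simp
  then have "\<psi> m = c - \<delta> / 4" using bd[of m] by (simp add: \<psi>_def)
  then show ?thesis using max[OF z] by (simp add: \<psi>_def algebra_simps)
qed

text \<open>The quadratic upper bound touches \<open>f\<close> at \<open>1\<close> and has slope \<open>\<delta>/2\<close> there.\<close>

lemma boundary_derivative_ge:
  fixes f :: "real \<Rightarrow> real"
  assumes f: "(f has_real_derivative D) (at 1 within {0..1})" and f1: "f 1 = c"
    and le: "\<And>r. r \<in> {0..1} \<Longrightarrow> f r \<le> c - \<delta> / 4 * (1 - r\<^sup>2)"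
  shows "\<delta> / 2 \<le> D"
proof (rule ccontr)
  assume "\<not> \<delta> / 2 \<le> D"
  let ?k = "\<lambda>r. f r - \<delta> / 4 * r\<^sup>2"
  have "(?k has_real_derivative D - \<delta> / 2) (at 1 within {0..1})"
    by (rule DERIV_diff[OF f]) (auto intro!: derivative_eq_intros)
  from has_real_derivative_neg_dec_left[OF this] \<open>\<not> \<delta> / 2 \<le> D\<close>
  obtain d where d: "d > 0" "\<And>h. 0 < h \<Longrightarrow> 1 - h \<in> {0..1} \<Longrightarrow> h < d \<Longrightarrow> ?k 1 < ?k (1 - h)"
    by auto
  define h where "h = min (d / 2) 1"
  have "?k 1 < ?k (1 - h)" using d(1) by (intro d(2)) (auto simp: h_def)
  moreover have "f (1 - h) \<le> c - \<delta> / 4 * (1 - (1 - h)\<^sup>2)"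
    using d(1) by (intro le) (auto simp: h_def)
  ultimately show False using f1 by (simp add: algebra_simps)
qed

section \<open>Discs of a filling\<close>

lemma bounded_linear_vector_smult: "bounded_linear (\<lambda>v. (d::complex) *s (v :: complex^'n))"
proof (rule bounded_linear_intro[where K = "cmod d"])
  show "norm (d *s v) \<le> norm v * cmod d" for v :: "complex^'n"
    by (simp add: norm_vec_def L2_set_def norm_mult power_mult_distrib
        sum_distrib_left[symmetric] real_sqrt_mult)
qed (simp_all add: vec_eq_iff algebra_simps)

lemma has_vector_derivative_vec_lambda:
  fixes f :: "'n::finite \<Rightarrow> real \<Rightarrow> 'b::euclidean_space"
  assumes "\<And>k. (f k has_vector_derivative f' k) (at s within S)"
  shows "((\<lambda>s. \<chi> k. f k s) has_vector_derivative (\<chi> k. f' k)) (at s within S)"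
  unfolding has_vector_derivative_def has_derivative_componentwise_within[of "\<lambda>s. \<chi> k. f k s"]
proof
  fix i :: "'b^'n" assume "i \<in> Basis"
  then obtain k b where i: "i = axis k b" by (auto simp: Basis_vec_def)
  have "((\<lambda>s. f k s \<bullet> b) has_derivative (\<lambda>h. (h *\<^sub>R f' k) \<bullet> b)) (at s within S)"
    using assms[of k] unfolding has_vector_derivative_def by (rule has_derivative_inner_left)
  then show "((\<lambda>s. (\<chi> k. f k s) \<bullet> i) has_derivative (\<lambda>h. (h *\<^sub>R (\<chi> k. f' k)) \<bullet> i)) (at s within S)"
    by (simp add: i inner_axis)
qed

abbreviation solid_cylinder :: "(real \<times> complex) set" where
  "solid_cylinder \<equiv> UNIV \<times> cball 0 1"

lemma solid_cylinder: "convex solid_cylinder" "interior solid_cylinder = UNIV \<times> ball 0 1"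
  "interior solid_cylinder \<noteq> {}"
  by (simp_all add: convex_Times interior_Times)

lemma disc_derivative_interior:
  assumes F: "smooth_on solid_cylinder F" and hol: "holomorphic_disc (\<lambda>z. F (t, z))"
    and z: "z \<in> ball 0 1"
  shows "frechet_derivative F (at (t, z) within solid_cylinder) (0, d)
    = d *s (\<chi> k. deriv (\<lambda>z. F (t, z) $ k) z)"
proof -
  have "(t, z) \<in> interior solid_cylinder" using z by (simp add: solid_cylinder)
  then have "at (t, z) within solid_cylinder = at (t, z)" by (rule at_within_interior)
  then have DF: "(F has_derivative frechet_derivative F (at (t, z) within solid_cylinder)) (at (t, z))"
    using smooth_on_has_derivative[OF F solid_cylinder(1,3), of "(t, z)"] z by simp
  have "((\<lambda>z. (t, z)) has_derivative (\<lambda>d. (0, d))) (at z)"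
    by (auto intro!: derivative_eq_intros)
  from has_derivative_compose[OF this DF]
  have "((\<lambda>z. F (t, z) $ k) has_derivative
      (\<lambda>d. frechet_derivative F (at (t, z) within solid_cylinder) (0, d) $ k)) (at z)" for k
    by (rule bounded_linear.has_derivative[OF bounded_linear_vec_nth])
  moreover have "((\<lambda>z. F (t, z) $ k) has_derivative (*) (deriv (\<lambda>z. F (t, z) $ k) z)) (at z)" for k
    using hol z holomorphic_derivI[of "\<lambda>z. F (t, z) $ k" "ball 0 1" z]
    by (simp add: holomorphic_disc_def has_field_derivative_def)
  ultimately have "(\<lambda>d. frechet_derivative F (at (t, z) within solid_cylinder) (0, d) $ k)
      = (*) (deriv (\<lambda>z. F (t, z) $ k) z)" for k
    by (rule has_derivative_unique)
  from fun_cong[OF this, of d] show ?thesis by (simp add: vec_eq_iff mult.commute)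
qed

text \<open>Holomorphicity gives this inside the disc; both sides are continuous up to the boundary.\<close>

lemma disc_derivative_complex_linear:
  assumes F: "smooth_on solid_cylinder F" and hol: "holomorphic_disc (\<lambda>z. F (t, z))"
    and z: "z \<in> cball 0 1"
  shows "frechet_derivative F (at (t, z) within solid_cylinder) (0, d)
    = d *s frechet_derivative F (at (t, z) within solid_cylinder) (0, 1)" (is "?D z d = d *s ?D z 1")
proof -
  have cont: "continuous_on (cball 0 1) (\<lambda>z. ?D z d)" for d
    by (intro smooth_on_continuous_derivative_compose[OF F solid_cylinder(1,3)] continuous_intros) auto
  have "continuous_on (cball 0 1) (\<lambda>z. ?D z d - d *s ?D z 1)"
    by (intro continuous_on_diff cont
        bounded_linear.continuous_on[OF bounded_linear_vector_smult])
  then have "continuous_on (closure (ball 0 1)) (\<lambda>z. ?D z d - d *s ?D z 1)"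
    by simp
  from continuous_constant_on_closure[OF this, of 0 z]
  have "?D z d - d *s ?D z 1 = 0"
    using z by (simp add: disc_derivative_interior[OF F hol])
  then show ?thesis by simp
qed

text \<open>Discs of a filling leave the sublevel set transversely: the Hopf boundary lemma for \<open>H\<close> on a
  disc. For \<open>u = F(t, \<cdot>)\<close> the Laplacian of \<open>H \<circ> u\<close> is the Levi form of \<open>H\<close> on \<open>u'\<close>, the terms with \<open>u''\<close>
  cancelling between the directions \<open>1\<close> and \<open>\<i>\<close>. Because \<open>u\<close> is immersed up to the boundary, it is
  bounded below by a positive constant on the whole closed disc, so a parabola serves as the
  barrier.\<close>

lemma disc_boundary_derivative_pos:
  fixes F :: "real \<times> complex \<Rightarrow> complex^2"
  assumes H: "smooth_on UNIV H" and psh: "strictly_psh H"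
    and imm: "immersion_on solid_cylinder F" and hol: "holomorphic_disc (\<lambda>z. F (t, z))"
    and bd: "\<And>z. z \<in> sphere 0 1 \<Longrightarrow> H (F (t, z)) = c"
    and z0: "z0 \<in> sphere 0 1"
  shows "0 < frechet_derivative H (at (F (t, z0)))
    (frechet_derivative F (at (t, z0) within solid_cylinder) (0, z0))"
proof -
  have F: "smooth_on solid_cylinder F"
    and inj: "\<And>x. x \<in> solid_cylinder \<Longrightarrow> inj (frechet_derivative F (at x within solid_cylinder))"
    using imm unfolding immersion_on_def by auto
  let ?DF = "\<lambda>z. frechet_derivative F (at (t, z) within solid_cylinder)"
  let ?dH = "\<lambda>p. frechet_derivative H (at p)"
  define u where "u z = F (t, z)" for z
  define U where "U z = ?DF z (0, 1)" for z
  define W where "W z = (\<chi> k. deriv (deriv (\<lambda>z. F (t, z) $ k)) z)" for z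
  have contU: "continuous_on (cball 0 1) U"
    unfolding U_def
    by (intro smooth_on_continuous_derivative_compose[OF F solid_cylinder(1,3)] continuous_intros) auto
  have curve_u: "((\<lambda>s. u (m s)) has_vector_derivative ?DF (m s) (0, m')) (at s within I)"
    if m: "(m has_vector_derivative m') (at s within I)" "m ` I \<subseteq> cball 0 1" "s \<in> I" for m m' s I
  proof -
    have "((\<lambda>s. (t, m s)) has_vector_derivative (0, m')) (at s within I)"
      by (intro has_vector_derivative_Pair m derivative_intros)
    from smooth_on_compose_curve[OF F solid_cylinder(1,3) this] m(2,3) show ?thesis
      by (auto simp: u_def)
  qed
  have DF: "?DF z (0, d) = d *s U z" if "z \<in> cball 0 1" for z d
    unfolding U_def by (rule disc_derivative_complex_linear[OF F hol that])
  have contu: "continuous_on (cball 0 1) u"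
  proof -
    have "continuous_on solid_cylinder F"
      using smooth_on_has_derivative[OF F solid_cylinder(1,3)] has_derivative_continuous
      by (metis continuous_on_eq_continuous_within)
    then show ?thesis
      unfolding u_def by (rule continuous_on_compose2) (auto intro!: continuous_intros)
  qed
  have U0: "U z \<noteq> 0" if z: "z \<in> cball 0 1" for z
  proof
    assume "U z = 0"
    have "linear (?DF z)"
      by (rule smooth_on_derivative_linear[OF F solid_cylinder(1,3)]) (use z in simp)
    then have "?DF z (0, 1) = ?DF z 0" using \<open>U z = 0\<close> by (simp add: U_def linear_0)
    then show False using injD[OF inj, of "(t, z)" "(0, 1)" 0] z by (simp add: zero_prod_def)
  qed
  define lev where "lev z = hess H (u z) (U z) (U z) + hess H (u z) (\<i> *s U z) (\<i> *s U z)" for z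
  have "continuous_on (cball 0 1) lev"
    unfolding lev_def
    by (intro continuous_on_add continuous_on_hess[OF H] contu contU
        bounded_linear.continuous_on[OF bounded_linear_vector_smult])
  then obtain m where m: "m \<in> cball 0 1" "\<And>z. z \<in> cball 0 1 \<Longrightarrow> lev m \<le> lev z"
    using continuous_attains_inf[of "cball (0::complex) 1" lev] by auto
  \<comment> \<open>Half of the minimum, so that the lower bound for the Laplacian is strict.\<close>
  define \<delta> where "\<delta> = lev m / 2"
  have \<delta>: "0 < \<delta>" unfolding \<delta>_def lev_def using levi_form_pos[OF H psh U0[OF m(1)]] by simp
  have lev_\<delta>: "\<delta> < lev z" if "z \<in> cball 0 1" for z
    using m(2)[OF that] \<delta> by (simp add: \<delta>_def)
  have line: "((\<lambda>s. z + of_real s * d) has_vector_derivative d) (at s)" for z d :: complex and s :: real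
    by (auto intro!: derivative_eq_intros simp: has_vector_derivative_def scaleR_conv_of_real)
  have curve_u_at: "((\<lambda>s. u (z + of_real s * d)) has_vector_derivative d *s U (z + of_real s * d)) (at s)"
    if z: "z + of_real s * d \<in> ball 0 1" for z d s
  proof -
    define I where "I = (\<lambda>s. z + of_real s * d) -` ball 0 1"
    have I: "open I" "s \<in> I" unfolding I_def using z
      by (auto intro!: open_vimage continuous_intros)
    have "(\<lambda>s. z + of_real s * d) ` I \<subseteq> cball 0 1" unfolding I_def by auto
    then have "((\<lambda>s. u (z + of_real s * d)) has_vector_derivative
        ?DF (z + of_real s * d) (0, d)) (at s within I)"
      by (intro curve_u[OF has_vector_derivative_at_within[OF line[of z d s]] _ I(2)])
    moreover have "?DF (z + of_real s * d) (0, d) = d *s U (z + of_real s * d)"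
      by (rule DF) (use z in simp)
    ultimately show ?thesis
      unfolding at_within_open[OF I(2,1)] by (simp only:)
  qed
  have curve_U: "((\<lambda>s. U (z + of_real s * d)) has_vector_derivative d *s W z) (at 0)"
    if z: "z \<in> ball 0 1" for z d
  proof -
    let ?g = "\<lambda>k z. deriv (\<lambda>z. F (t, z) $ k) z"
    have hk: "(\<lambda>z. F (t, z) $ k) holomorphic_on ball 0 1" for k
      using hol by (simp add: holomorphic_disc_def)
    have g: "(?g k has_field_derivative deriv (?g k) z) (at z)" for k
      by (rule holomorphic_derivI[OF holomorphic_deriv[OF hk open_ball] open_ball z])
    have "((\<lambda>s. ?g k (z + of_real s * d)) has_vector_derivative d * deriv (?g k) z) (at (0::real))" for k
      using field_vector_diff_chain_at[OF line[of z d 0], of "?g k" "deriv (?g k) z"] g[of k]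
      by (simp add: o_def)
    from has_vector_derivative_vec_lambda[OF this]
    have "((\<lambda>s. \<chi> k. ?g k (z + of_real s * d)) has_vector_derivative (\<chi> k. d * deriv (?g k) z)) (at (0::real))" .
    then have "((\<lambda>s. U (z + of_real s * d)) has_vector_derivative (\<chi> k. d * deriv (?g k) z)) (at (0::real))"
    proof (rule has_vector_derivative_transform_within_open)
      show "open ((\<lambda>s::real. z + of_real s * d) -` ball 0 1)"
        by (auto intro!: open_vimage continuous_intros)
      show "(\<chi> k. ?g k (z + of_real s * d)) = U (z + of_real s * d)"
        if "s \<in> (\<lambda>s::real. z + of_real s * d) -` ball 0 1" for s
        using disc_derivative_interior[OF F hol, of "z + of_real s * d" 1] that
        by (simp add: U_def)
    qed (use z in simp)
    moreover have "(\<chi> k. d * deriv (?g k) z) = d *s W z"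
      by (simp add: W_def vec_eq_iff)
    ultimately show ?thesis by simp
  qed
  define P where "P d z = ?dH (u z) (d *s U z)" for d z
  define Q where "Q d z = hess H (u z) (d *s U z) (d *s U z) + ?dH (u z) (d *s (d *s W z))" for d z
  have D1: "((\<lambda>s. H (u (z + of_real s * d))) has_real_derivative P d (z + of_real s * d)) (at s)"
    if z: "z + of_real s * d \<in> ball 0 1" for d z and s :: real
    using smooth_on_compose_curve[OF H _ _ curve_u_at[OF z]]
    by (simp add: has_real_derivative_iff_has_vector_derivative P_def)
  have D2: "((\<lambda>s. P d (z + of_real s * d)) has_real_derivative Q d z) (at 0)"
    if z: "z \<in> ball 0 1" for d z
  proof -
    have "((\<lambda>s. u (z + of_real s * d)) has_vector_derivative d *s U z) (at 0)"
      using curve_u_at[of z 0 d] z by simp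
    moreover have "((\<lambda>s. d *s U (z + of_real s * d)) has_vector_derivative d *s (d *s W z)) (at 0)"
      by (rule bounded_linear.has_vector_derivative[OF bounded_linear_vector_smult curve_U[OF z]])
    ultimately show ?thesis
      unfolding P_def Q_def
      using derivative_along_curve_has_derivative[OF H, of "\<lambda>s. u (z + of_real s * d)" _ 0] by force
  qed
  have lap: "\<delta> < Q 1 z + Q \<i> z" if z: "z \<in> ball 0 1" for z
  proof -
    have "\<i> *s (\<i> *s W z) = - W z" by (simp add: vec_eq_iff)
    then have "Q 1 z + Q \<i> z = lev z"
      unfolding Q_def lev_def
      by (simp add: linear_neg[OF smooth_derivative_linear[OF H]])
    then show ?thesis using lev_\<delta>[of z] z by simp
  qed
  have contH: "continuous_on UNIV H"
    using has_derivative_continuous[OF smooth_has_derivative[OF H]]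
    by (simp add: continuous_on_eq_continuous_at)
  have below: "H (u z) \<le> c - \<delta> / 4 * (1 - (cmod z)\<^sup>2)" if "z \<in> cball 0 1" for z
  proof (rule strict_laplacian_max_principle[OF _ _ D1 D2 lap that])
    show "continuous_on (cball 0 1) (\<lambda>z. H (u z))"
      by (rule continuous_on_compose2[OF contH contu]) simp
    show "H (u z) = c" if "z \<in> sphere 0 1" for z
      using bd[OF that] by (simp add: u_def)
  qed
  have "((\<lambda>r. u (of_real r * z0)) has_vector_derivative ?DF (of_real 1 * z0) (0, z0)) (at 1 within {0..1})"
  proof (rule curve_u)
    show "((\<lambda>r. of_real r * z0) has_vector_derivative z0) (at 1 within {0..1})"
      using has_vector_derivative_at_within[OF line[of 0 z0 1]] by simp
  qed (use z0 in \<open>auto simp: norm_mult\<close>)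
  from smooth_on_compose_curve[OF H _ _ this]
  have "((\<lambda>r. H (u (of_real r * z0))) has_real_derivative ?dH (u z0) (?DF z0 (0, z0)))
      (at 1 within {0..1})"
    by (simp add: has_real_derivative_iff_has_vector_derivative)
  then have "\<delta> / 2 \<le> ?dH (u z0) (?DF z0 (0, z0))"
  proof (rule boundary_derivative_ge)
    show "H (u (of_real 1 * z0)) = c" using bd[OF z0] by (simp add: u_def)
    show "H (u (of_real r * z0)) \<le> c - \<delta> / 4 * (1 - r\<^sup>2)" if "r \<in> {0..1}" for r
      using below[of "of_real r * z0"] that z0 by (simp add: norm_mult)
  qed
  then show ?thesis using \<delta> by (simp add: u_def)
qed

section \<open>Characteristics as graphs\<close>

lemma cis_has_vector_derivative:
  assumes "(f has_real_derivative f') (at s within S)"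
  shows "((\<lambda>s. cis (f s)) has_vector_derivative f' *\<^sub>R (\<i> * cis (f s))) (at s within S)"
  unfolding has_vector_derivative_def
  using assms
  by (auto intro!: derivative_eq_intros
      simp: has_field_derivative_def fun_eq_iff scaleR_conv_of_real)

lemma loclip_at_cis: "loclip_at cis x"
proof -
  have "1-lipschitz_on UNIV cis"
  proof (rule bounded_derivative_imp_lipschitz)
    show "(cis has_derivative (\<lambda>h. h *\<^sub>R (\<i> * cis x))) (at x within UNIV)" for x
      using cis_has_vector_derivative[of "\<lambda>x. x" 1 x UNIV]
      by (simp add: has_vector_derivative_def)
    show "onorm (\<lambda>h. h *\<^sub>R (\<i> * cis x)) \<le> 1" for x
      by (rule onorm_le) (simp add: norm_mult)
  qed simp_all
  then have "1-lipschitz_on (ball x 1) cis" by (rule lipschitz_on_subset) simp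
  then show ?thesis unfolding loclip_at_def using zero_less_one by blast
qed

lemma tangent_space_cylinder:
  "(\<kappa>::real, \<rho> *\<^sub>R (\<i> * cis \<theta>)) \<in> tangent_space (UNIV \<times> sphere 0 1) (t, cis \<theta>)"
proof -
  define \<sigma> where "\<sigma> s = (t + \<kappa> * s, cis (\<theta> + \<rho> * s))" for s
  have d: "(\<sigma> has_vector_derivative (\<kappa>, \<rho> *\<^sub>R (\<i> * cis (\<theta> + \<rho> * s)))) (at s)" for s
    unfolding \<sigma>_def
    by (intro has_vector_derivative_Pair cis_has_vector_derivative)
      (auto intro!: derivative_eq_intros simp: has_real_derivative_iff_has_vector_derivative[symmetric])
  have "\<sigma> C1_differentiable_on {-1<..<1}"
    by (rule C1_on_vector_derivativeI[OF d]) (intro continuous_intros)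
  moreover have "\<sigma> ` {-1<..<1} \<subseteq> UNIV \<times> sphere 0 1" by (auto simp: \<sigma>_def)
  moreover have "\<sigma> 0 = (t, cis \<theta>)" by (simp add: \<sigma>_def)
  moreover have "(\<sigma> has_vector_derivative (\<kappa>, \<rho> *\<^sub>R (\<i> * cis \<theta>))) (at 0)"
    using d[of 0] by simp
  ultimately show ?thesis
    unfolding tangent_space_def using zero_less_one by blast
qed

text \<open>A vector tangent to \<open>M\<close> is a complex tangency as soon as multiplication by \<open>\<i>\<close> keeps it in the
  kernel of \<open>dH\<close>; this is the contact form \<open>-dH \<circ> \<i>\<close> vanishing on it.\<close>

lemma char_lineI:
  assumes H: "smooth_on UNIV H" and reg: "regular_value H c" and M: "M = H -` {c}"
    and T: "T \<subseteq> M" "q \<in> T" and v: "v \<in> tangent_space T q"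
    and iv: "frechet_derivative H (at q) (\<i> *s v) = 0"
  shows "v \<in> char_line M T q"
proof -
  have q: "H q = c" using T M by auto
  then have "surj (frechet_derivative H (at q))"
    using reg by (simp add: regular_value_def)
  then obtain n where n: "frechet_derivative H (at q) n = 1" by (metis surjD)
  have "frechet_derivative H (at q) (- (\<i> *s v)) = 0"
    using linear_neg[OF smooth_derivative_linear[OF H]] iv by simp
  then have "- (\<i> *s v) \<in> tangent_space M q"
    unfolding M using kernel_subset_tangent_level_set[OF H q, of n] n by simp
  moreover have "v = \<i> *s (- (\<i> *s v))" by (simp add: vec_eq_iff)
  moreover have "v \<in> tangent_space M q" using v tangent_space_mono[OF T(1)] by blast
  ultimately show ?thesis
    unfolding char_line_def complex_tangencies_def using v by blast
qed

text \<open>The contact form \<open>-dH \<circ> \<i>\<close>, pulled back to the cylinder with coordinates \<open>(t, \<theta>)\<close>, reads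
  \<open>f dt + g d\<theta>\<close>, where \<open>g\<close> is its value on the velocity \<open>\<i> z u'(z)\<close> of the boundary circle, namely
  \<open>dH (z u'(z)) > 0\<close>. The characteristics therefore are never vertical: they have the slope
  \<open>h = - f / g\<close>. In the proof \<open>\<beta>\<close> is the negative of the pulled back form.\<close>

lemma characteristic_slope:
  fixes F :: "real \<times> complex \<Rightarrow> complex^2"
  assumes H: "smooth_on UNIV H" and psh: "strictly_psh H"
    and imm: "immersion_on solid_cylinder F" and hol: "\<And>t. holomorphic_disc (\<lambda>z. F (t, z))"
    and bd: "\<And>t z. z \<in> sphere 0 1 \<Longrightarrow> H (F (t, z)) = c"
  obtains h :: "real \<Rightarrow> real \<Rightarrow> real" where
    "\<And>t x. loclip_at (\<lambda>(t, x). h t x) (t, x)"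
    "\<And>t x k::int. h t (x + 2 * pi * of_int k) = h t x"
    "\<And>t x. frechet_derivative H (at (F (t, cis x)))
      (\<i> *s frechet_derivative F (at (t, cis x) within solid_cylinder) (1, h t x *\<^sub>R (\<i> * cis x))) = 0"
proof -
  have F: "smooth_on solid_cylinder F" using imm unfolding immersion_on_def by blast
  define \<beta> where "\<beta> t x w = frechet_derivative H (at (F (t, cis x)))
      (\<i> *s frechet_derivative F (at (t, cis x) within solid_cylinder) w)" for t x w
  have lin: "linear (\<beta> t x)" for t x
  proof -
    have "linear (frechet_derivative F (at (t, cis x) within solid_cylinder))"
      by (rule smooth_on_derivative_linear[OF F solid_cylinder(1,3)]) simp
    from linear_compose[OF linear_compose[OF this
          bounded_linear.linear[OF bounded_linear_vector_smult[of \<i>]]]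
        smooth_derivative_linear[OF H, of "F (t, cis x)"]]
    show ?thesis by (simp add: \<beta>_def[abs_def] o_def)
  qed
  have neg: "\<beta> t x (0, \<i> * cis x) < 0" for t x
  proof -
    let ?D = "\<lambda>d. frechet_derivative F (at (t, cis x) within solid_cylinder) (0, d)"
    have D: "?D d = d *s ?D 1" for d
      by (rule disc_derivative_complex_linear[OF F hol]) simp
    \<comment> \<open>Rotating the velocity of the boundary circle by \<open>\<i>\<close> gives the inner normal of the disc.\<close>
    have "\<i> *s ?D (\<i> * cis x) = - ?D (cis x)"
      unfolding D[of "\<i> * cis x"] D[of "cis x"] by (simp add: vec_eq_iff)
    then have "\<beta> t x (0, \<i> * cis x) = - frechet_derivative H (at (F (t, cis x))) (?D (cis x))"
      unfolding \<beta>_def by (simp add: linear_neg[OF smooth_derivative_linear[OF H]])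
    moreover have "0 < frechet_derivative H (at (F (t, cis x))) (?D (cis x))"
      by (rule disc_boundary_derivative_pos[OF H psh imm hol bd]) simp_all
    ultimately show ?thesis by simp
  qed
  have ll: "loclip_at (\<lambda>p. \<beta> (fst p) (snd p) (w p)) q" if w: "loclip_at w q" for w q
  proof -
    have m: "loclip_at (\<lambda>p. (fst p, cis (snd p))) q"
      by (intro loclip_at_Pair loclip_at_compose[OF _ loclip_at_cis] loclip_at_bounded_linear
          bounded_linear_fst bounded_linear_snd)
    have r: "range (\<lambda>p. (fst p, cis (snd p))) \<subseteq> solid_cylinder" by auto
    note Fm = smooth_on_loclip_compose[OF F solid_cylinder(1,3) m r]
    have "loclip_at (\<lambda>p. \<i> *s frechet_derivative F (at (fst p, cis (snd p)) within solid_cylinder) (w p)) q"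
      by (rule loclip_at_bounded_linear_compose[OF bounded_linear_vector_smult Fm(2)[OF w]])
    from smooth_on_loclip_compose(2)[OF H _ _ Fm(1) _ this] show ?thesis
      unfolding \<beta>_def by simp
  qed
  define h where "h t x = - \<beta> t x (1, 0) * inverse (\<beta> t x (0, \<i> * cis x))" for t x
  show thesis
  proof (rule that[of h])
    fix t x and k :: int
    show "loclip_at (\<lambda>(t, x). h t x) (t, x)"
    proof -
      have "loclip_at (\<lambda>p. (0::real, \<i> * cis (snd p))) (t, x)"
        by (intro loclip_at_Pair loclip_at_const
            loclip_at_bounded_linear_compose[OF bounded_linear_mult_right]
            loclip_at_compose[OF _ loclip_at_cis] loclip_at_bounded_linear bounded_linear_snd)
      from loclip_at_inverse[OF ll[OF this]]
      have "loclip_at (\<lambda>p. inverse (\<beta> (fst p) (snd p) (0, \<i> * cis (snd p)))) (t, x)"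
        using neg[of t x] by simp
      moreover have "loclip_at (\<lambda>p. - \<beta> (fst p) (snd p) (1, 0)) (t, x)"
        by (rule loclip_at_bounded_linear_compose[OF bounded_linear_minus[OF bounded_linear_ident]
              ll[OF loclip_at_const]])
      ultimately have "loclip_at (\<lambda>p. (- \<beta> (fst p) (snd p) (1, 0)) *\<^sub>R
          inverse (\<beta> (fst p) (snd p) (0, \<i> * cis (snd p)))) (t, x)"
        by (intro loclip_at_scaleR)
      then show ?thesis by (simp add: h_def case_prod_beta')
    qed
    have "cis (x + 2 * pi * of_int k) = cis x"
      using cis_multiple_2pi[of "of_int k"] by (simp add: cis_mult[symmetric])
    then show "h t (x + 2 * pi * of_int k) = h t x" by (simp add: h_def \<beta>_def)
    have "(1, h t x *\<^sub>R (\<i> * cis x)) = (1, 0) + h t x *\<^sub>R (0::real, \<i> * cis x)" by simp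
    then have "\<beta> t x (1, h t x *\<^sub>R (\<i> * cis x)) = \<beta> t x (1, 0) + h t x * \<beta> t x (0, \<i> * cis x)"
      by (simp only: linear_add[OF lin] linear_scale[OF lin] real_scaleR_def)
    also have "\<dots> = 0" using neg[of t x] by (simp add: h_def)
    finally show "frechet_derivative H (at (F (t, cis x)))
      (\<i> *s frechet_derivative F (at (t, cis x) within solid_cylinder) (1, h t x *\<^sub>R (\<i> * cis x))) = 0"
      by (simp add: \<beta>_def)
  qed
qed

text \<open>The leaf through \<open>(t0, z0)\<close> is the graph over \<open>t\<close> of a solution of \<open>d\<theta>/dt = h t \<theta>\<close>, and solutions
  exist for all time since \<open>h\<close> is periodic in \<open>\<theta>\<close>. Reparametrizing by \<open>t = t0 + \<kappa> s\<close> with \<open>\<kappa> = t1 - t0\<close> sends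
  the unit interval to the piece between the levels \<open>t0\<close> and \<open>t1\<close>, in either direction.\<close>

lemma leaf_reaches_every_level:
  assumes h: "\<And>t x. loclip_at (\<lambda>(t, x). h t x) (t, x)"
    and per: "\<And>t x k::int. h t (x + 2 * pi * of_int k) = h t x"
    and L: "\<And>\<kappa> t x. (\<kappa>, (\<kappa> * h t x) *\<^sub>R (\<i> * cis x)) \<in> L (t, cis x)"
    and p: "p \<in> cylinder a b" and t1: "t1 \<in> {a..b}"
  shows "leaf_through (cylinder a b) L p \<inter> ({t1} \<times> sphere 0 1) \<noteq> {}"
proof -
  obtain t0 z0 where tz: "p = (t0, z0)" "t0 \<in> {a..b}" "cmod z0 = 1"
    using p by (auto simp: cylinder_def)
  define \<theta>0 where "\<theta>0 = Arg z0"
  have z0: "z0 = cis \<theta>0"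
    using tz(3) rcis_cmod_Arg[of z0] by (simp add: \<theta>0_def rcis_def)
  define \<kappa> where "\<kappa> = t1 - t0"
  define k where "k s y = \<kappa> * h (t0 + \<kappa> * s) y" for s y
  have kl: "loclip_at (\<lambda>(s, y). k s y) (s, y)" for s y
  proof -
    have "loclip_at (\<lambda>p. (t0 + \<kappa> * fst p, snd p)) (s, y)"
      by (intro loclip_at_Pair loclip_at_add loclip_at_const loclip_at_bounded_linear
          bounded_linear_const_mult bounded_linear_fst bounded_linear_snd)
    moreover have "loclip_at (\<lambda>(t, x). h t x) (t0 + \<kappa> * fst (s, y), snd (s, y))"
      using h by simp
    ultimately have "loclip_at (\<lambda>p. (\<lambda>(t, x). h t x) (t0 + \<kappa> * fst p, snd p)) (s, y)"
      by (rule loclip_at_compose)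
    from loclip_at_bounded_linear_compose[OF bounded_linear_mult_right[of \<kappa>] this]
    show ?thesis by (simp add: k_def case_prod_beta')
  qed
  have contk: "continuous_on UNIV (\<lambda>(s, y). k s y)"
  proof (intro continuous_at_imp_continuous_on ballI)
    show "isCont (\<lambda>(s, y). k s y) q" for q
      using loclip_at_isCont[OF kl, of "fst q" "snd q"] by simp
  qed
  have "\<exists>K. \<forall>s. \<bar>s\<bar> \<le> R \<longrightarrow> K-lipschitz_on UNIV (k s)" for R
    using kl by (rule periodic_loclip_imp_lipschitz) (simp add: k_def per)
  then obtain x where x0: "x 0 = \<theta>0" and dx: "\<And>s. (x has_vector_derivative k s (x s)) (at s)"
    using global_Picard_Lindeloef[OF contk, of \<theta>0] by blast
  define \<gamma> where "\<gamma> s = (t0 + \<kappa> * s, cis (x s))" for s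
  define \<gamma>' where "\<gamma>' s = (\<kappa>, (\<kappa> * h (t0 + \<kappa> * s) (x s)) *\<^sub>R (\<i> * cis (x s)))" for s
  have d\<gamma>: "(\<gamma> has_vector_derivative \<gamma>' s) (at s)" for s
    unfolding \<gamma>_def \<gamma>'_def
  proof (intro has_vector_derivative_Pair cis_has_vector_derivative)
    show "((\<lambda>s. t0 + \<kappa> * s) has_vector_derivative \<kappa>) (at s)"
      unfolding has_real_derivative_iff_has_vector_derivative[symmetric]
      by (auto intro!: derivative_eq_intros)
    show "(x has_real_derivative \<kappa> * h (t0 + \<kappa> * s) (x s)) (at s)"
      using dx[of s] by (simp add: has_real_derivative_iff_has_vector_derivative k_def)
  qed
  have contx: "continuous_on UNIV x"
    by (rule continuous_on_of_vector_derivative[OF dx])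
  have "continuous_on {0..1} \<gamma>'"
  proof -
    have "continuous_on UNIV (\<lambda>s. (s, x s))" by (intro continuous_intros contx)
    from continuous_on_compose2[OF contk this] have "continuous_on UNIV (\<lambda>s. k s (x s))" by simp
    then have "continuous_on UNIV \<gamma>'"
      unfolding \<gamma>'_def k_def[symmetric] by (intro continuous_intros contx)
    then show ?thesis by (rule continuous_on_subset) simp
  qed
  then have "\<gamma> C1_differentiable_on {0..1}"
    by (rule C1_on_vector_derivativeI[OF d\<gamma>])
  moreover have "\<gamma> ` {0..1} \<subseteq> cylinder a b"
  proof -
    have "t0 + \<kappa> * s \<in> {a..b}" if "s \<in> {0..1}" for s
    proof -
      have "t0 + \<kappa> * s = (1 - s) *\<^sub>R t0 + s *\<^sub>R t1" by (simp add: \<kappa>_def algebra_simps)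
      then show ?thesis
        using convexD[of "{a..b}" t0 t1 "1 - s" s] that tz(2) t1 by simp
    qed
    then show ?thesis by (auto simp: \<gamma>_def cylinder_def)
  qed
  moreover have "\<gamma> 0 = p" by (simp add: \<gamma>_def x0 tz z0)
  moreover have "vector_derivative \<gamma> (at s) \<in> L (\<gamma> s)" for s
    unfolding vector_derivative_at[OF d\<gamma>] by (simp add: \<gamma>_def \<gamma>'_def L)
  ultimately have "\<gamma> 1 \<in> leaf_through (cylinder a b) L p"
    unfolding leaf_through_def by (intro CollectI exI[of _ \<gamma>] conjI ballI) simp_all
  moreover have "\<gamma> 1 \<in> {t1} \<times> sphere 0 1" by (simp add: \<gamma>_def \<kappa>_def)
  ultimately have "\<gamma> 1 \<in> leaf_through (cylinder a b) L p \<inter> ({t1} \<times> sphere 0 1)" by (rule IntI)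
  then show ?thesis by (rule ex_in_conv[THEN iffD1, OF exI])
qed

theorem corollary1p3:
  fixes H :: "complex^2 \<Rightarrow> real" and c a b :: real
    and T M :: "(complex^2) set" and F :: "real \<times> complex \<Rightarrow> complex^2"
  assumes "smooth_on UNIV H" and "strictly_psh H" and "regular_value H c"
    and "M = H -` {c}"
    and "embedded_torus T" and "totally_real T" and "T \<subseteq> M"
    and "\<exists>\<epsilon> G. local_filling T \<epsilon> G"
    and "analytic_filling T F"
    and "a < b" and "b \<le> a + 2 * pi"
  shows "\<forall>l \<in> cylinder_characteristics M T F a b. \<not> trapped a b l"
proof -
  have imm: "immersion_on solid_cylinder F" and hol: "\<And>t. holomorphic_disc (\<lambda>z. F (t, z))"
    and FT: "F ` (UNIV \<times> sphere 0 1) = T"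
    using assms(9) unfolding analytic_filling_def by blast+
  have F: "smooth_on solid_cylinder F" using imm unfolding immersion_on_def by blast
  have T: "F (t, z) \<in> T" if "z \<in> sphere 0 1" for t z
    unfolding FT[symmetric] by (rule imageI) (use that in simp)
  have bd: "H (F (t, z)) = c" if "z \<in> sphere 0 1" for t z
    using T[OF that, of t] assms(4,7) by auto
  obtain h :: "real \<Rightarrow> real \<Rightarrow> real" where h: "\<And>t x. loclip_at (\<lambda>(t, x). h t x) (t, x)"
    "\<And>t x k::int. h t (x + 2 * pi * of_int k) = h t x"
    and ker: "\<And>t x. frechet_derivative H (at (F (t, cis x)))
      (\<i> *s frechet_derivative F (at (t, cis x) within solid_cylinder) (1, h t x *\<^sub>R (\<i> * cis x))) = 0"
    using characteristic_slope[OF assms(1,2) imm hol bd] by metis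
  let ?L = "pullback_line F (char_line M T)"
  have L: "(\<kappa>, (\<kappa> * h t x) *\<^sub>R (\<i> * cis x)) \<in> ?L (t, cis x)" for \<kappa> t x
  proof -
    let ?D = "frechet_derivative F (at (t, cis x) within solid_cylinder)"
    let ?w = "(\<kappa>, (\<kappa> * h t x) *\<^sub>R (\<i> * cis x))"
    have w: "?w \<in> tangent_space (UNIV \<times> sphere 0 1) (t, cis x)"
      by (rule tangent_space_cylinder)
    have "?D ?w \<in> tangent_space T (F (t, cis x))"
      using tangent_space_image[OF F solid_cylinder(1,3) _ w] FT by force
    moreover have "frechet_derivative H (at (F (t, cis x))) (\<i> *s ?D ?w) = 0"
    proof -
      have "linear ?D"
        by (rule smooth_on_derivative_linear[OF F solid_cylinder(1,3)]) simp
      moreover have "?w = \<kappa> *\<^sub>R (1, h t x *\<^sub>R (\<i> * cis x))" by simp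
      ultimately have "\<i> *s ?D ?w = \<kappa> *\<^sub>R (\<i> *s ?D (1, h t x *\<^sub>R (\<i> * cis x)))"
        using linear_scale[OF bounded_linear.linear[OF bounded_linear_vector_smult]]
        by (simp only: linear_scale)
      then show ?thesis
        using linear_scale[OF smooth_derivative_linear[OF assms(1)]] ker[of t x]
        by (simp only: real_scaleR_def mult_zero_right)
    qed
    ultimately have "?D ?w \<in> char_line M T (F (t, cis x))"
      by (intro char_lineI[OF assms(1,3,4,7)] T) auto
    with w show ?thesis unfolding pullback_line_def by blast
  qed
  have "\<not> trapped a b (leaf_through (cylinder a b) ?L p)" if p: "p \<in> cylinder a b" for p
    unfolding trapped_def
    using leaf_reaches_every_level[OF h L p, of a] leaf_reaches_every_level[OF h L p, of b] assms(10)
    by simp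
  then show ?thesis
    unfolding cylinder_characteristics_def leaves_def by blast
qed

end
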